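(* Let $W$ be a finite, irreducible complex reflection group of rank at least $2$, with reflection arrangement $\mathcal{A}(W)$. Then $\mathcal{A}(W)$ is supersolvable if and only if there exists a modular element of rank $2$ in the lattice $L(\mathcal{A}(W))$.
   Context: A finite complex reflection group is a finite subgroup $W\subseteq \mathrm{GL}(V)$, $V$ a finite-dimensional complex vector space, generated by reflections (elements of finite order whose fixed space is a hyperplane). It is irreducible if it acts irreducibly on $V$, and then its rank is $\ell=\dim V$. Its reflection arrangement $\mathcal{A}(W)$ is the set of the fixed hyperplanes of all reflections in $W$. For a finite set $\mathcal{A}$ of linear hyperplanes in $V$, $L(\mathcal{A})$ is the set of all intersections of subsets of $\mathcal{A}$ (with $V$ the empty intersection), ordered by reverse inclusion: $X\le Y$ iff $Y\subseteq X$. The rank of $X\in L(\mathcal{A})$ is $\operatorname{codim}_V X$. An element $X\in L(\mathcal{A})$ is modular if $X+Y\in L(\mathcal{A})$ for all $Y\in L(\mathcal{A})$. With $\ell=\dim V$, $\mathcal{A}$ is supersolvable if there is a maximal chain $V=X_0<X_1<\cdots<X_\ell=\{0\}$ of modular elements in $L(\mathcal{A})$. *)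

theory Defs
  imports Complex_Main "HOL-Algebra.Generated_Groups"
begin

definition intersection_lattice :: "'v set set \<Rightarrow> 'v set set" where
  "intersection_lattice \<A> = {\<Inter>\<B> |\<B>. \<B> \<subseteq> \<A>}"

definition modular_element :: "'v::ab_group_add set set \<Rightarrow> 'v set \<Rightarrow> bool" where
  "modular_element \<A> X \<longleftrightarrow>
     X \<in> intersection_lattice \<A> \<and>
     (\<forall>Y \<in> intersection_lattice \<A>. {x + y |x y. x \<in> X \<and> y \<in> Y} \<in> intersection_lattice \<A>)"

locale complex_space = vector_space scale
  for scale :: "complex \<Rightarrow> 'b::ab_group_add \<Rightarrow> 'b"
begin

definition GL :: "('b \<Rightarrow> 'b) monoid" where
  "GL = \<lparr>carrier = {g. Vector_Spaces.linear scale scale g \<and> bij g}, monoid.mult = (\<circ>), one = id\<rparr>"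

definition hyperplane :: "'b set \<Rightarrow> bool" where
  "hyperplane H \<longleftrightarrow> subspace H \<and> dim H + 1 = dim (UNIV :: 'b set)"

definition reflection :: "('b \<Rightarrow> 'b) \<Rightarrow> bool" where
  "reflection g \<longleftrightarrow>
     g \<in> carrier GL \<and> (\<exists>n>0. g ^^ n = id) \<and> hyperplane {v. g v = v}"

definition finite_reflection_group :: "('b \<Rightarrow> 'b) set \<Rightarrow> bool" where
  "finite_reflection_group W \<longleftrightarrow>
     subgroup W GL \<and> finite W \<and> W = generate GL {g \<in> W. reflection g}"

definition acts_irreducibly :: "('b \<Rightarrow> 'b) set \<Rightarrow> bool" where
  "acts_irreducibly W \<longleftrightarrow>
     (UNIV :: 'b set) \<noteq> {0} \<and>
     (\<forall>U. subspace U \<and> (\<forall>g\<in>W. g ` U \<subseteq> U) \<longrightarrow> U = {0} \<or> U = UNIV)"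

definition reflection_arrangement :: "('b \<Rightarrow> 'b) set \<Rightarrow> 'b set set" where
  "reflection_arrangement W = {{v. g v = v} |g. g \<in> W \<and> reflection g}"

definition codim :: "'b set \<Rightarrow> nat" where
  "codim X = dim (UNIV :: 'b set) - dim X"

text \<open>The lattice is ordered by reverse inclusion, so a chain that ascends in the lattice is a
  descending sequence of subspaces. The last conjunct expresses maximality of the chain.\<close>

definition supersolvable :: "'b set set \<Rightarrow> bool" where
  "supersolvable \<A> \<longleftrightarrow>
     (\<exists>X :: nat \<Rightarrow> 'b set.
        X 0 = UNIV \<and> X (dim (UNIV :: 'b set)) = {0} \<and>
        (\<forall>i \<le> dim (UNIV :: 'b set). modular_element \<A> (X i)) \<and>
        (\<forall>i < dim (UNIV :: 'b set). X (Suc i) \<subset> X i \<and>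
           \<not> (\<exists>Z \<in> intersection_lattice \<A>. X (Suc i) \<subset> Z \<and> Z \<subset> X i)))"

lemma group_GL: "group GL"
proof (rule groupI)
  fix g assume g: "g \<in> carrier GL"
  then have "bij g" and lin: "Vector_Spaces.linear scale scale g"
    by (auto simp: GL_def)
  interpret g: Vector_Spaces.linear scale scale g by (rule lin)
  have "Vector_Spaces.linear scale scale (inv_into UNIV g)"
  proof (unfold_locales)
    show "inv_into UNIV g (x + y) = inv_into UNIV g x + inv_into UNIV g y" for x y
      using \<open>bij g\<close> by (metis bij_inv_eq_iff g.add)
    show "inv_into UNIV g (scale r x) = scale r (inv_into UNIV g x)" for r x
      using \<open>bij g\<close> by (metis bij_inv_eq_iff g.scale)
  qed
  with \<open>bij g\<close> show "\<exists>h \<in> carrier GL. h \<otimes>\<^bsub>GL\<^esub> g = \<one>\<^bsub>GL\<^esub>"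
    by (intro bexI[of _ "inv_into UNIV g"]) (auto simp: GL_def bij_imp_bij_inv bij_is_inj)
qed (auto simp: GL_def bij_comp linear_id o_assoc intro: Vector_Spaces.linear_compose)

end

end

theory Submission
  imports Defs
begin

text \<open>Fix a \<open>W\<close>-invariant Hermitian form and pass to orthogonal complements: elements of the lattice
  become spans of roots (flats), and \<open>M\<close> is modular iff \<open>F \<inter> M\<close> is a flat for every flat \<open>F\<close>.
  The theorem follows without the classification of reflection groups once every modular flat \<open>M\<close> of
  dimension at least 2, together with a root \<open>q\<close> outside \<open>M\<close> and not orthogonal to \<open>M\<close>, is shown to
  span a modular flat \<open>N\<close>; irreducibility provides such a \<open>q\<close> as long as \<open>M\<close> is not everything.

  Suppose \<open>F \<inter> N\<close> is not a flat. As the conjugates of \<open>M\<close> in \<open>N\<close> are modular and have trivial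
  intersection, \<open>F \<inter> N\<close> is a line \<open>\<langle>p\<rangle>\<close> that lies in none of them. Modularity of \<open>M\<close>, applied to
  \<open>F + \<langle>r\<rangle>\<close>, shows that the projection of \<open>N\<close> onto \<open>M\<close> with centre \<open>p\<close> sends every root \<open>r\<close> to a root.
  Composed with the reflection in \<open>q\<close> it gives a root-preserving map of \<open>M\<close> that fixes
  the hyperplane orthogonal to \<open>q\<close> and moves vectors in the direction of the root \<open>b\<close>, the projection of \<open>q\<close>.
  Finiteness forces this map to be unitary, so \<open>b\<close> is proportional to the orthogonal projection of \<open>q\<close>
  to \<open>M\<close>. Letting \<open>q\<close> vary gives \<open>p \<bottom> M\<close>, and likewise for the conjugates of \<open>M\<close>, whence \<open>p \<bottom> N\<close>,
  a contradiction.\<close>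

section \<open>Hermitian spaces\<close>

text \<open>Definiteness is stated as anisotropy: it makes orthogonal projections exist and turns
  \<open>ip x x = 0\<close> into a contradiction for nonzero \<open>x\<close>.\<close>

locale hermitian_space = complex_space scale + finite_dimensional_vector_space scale Basis
  for scale :: "complex \<Rightarrow> 'v::ab_group_add \<Rightarrow> 'v" (infixr "*s" 75) and Basis :: "'v set" +
  fixes ip :: "'v \<Rightarrow> 'v \<Rightarrow> complex"
  assumes ip_add_left: "ip (u + v) w = ip u w + ip v w"
    and ip_scale_left: "ip (c *s v) w = c * ip v w"
    and ip_commute: "ip v w = cnj (ip w v)"
    and ip_self_eq_0: "ip v v = 0 \<Longrightarrow> v = 0"
begin

lemma ip_add_right: "ip w (u + v) = ip w u + ip w v"
  using ip_add_left[of u v w] ip_commute[of w "u + v"] ip_commute[of w u] ip_commute[of w v] by simp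

lemma ip_scale_right: "ip w (c *s v) = cnj c * ip w v"
  using ip_scale_left[of c v w] ip_commute[of w "c *s v"] ip_commute[of w v] by simp

lemma ip_zero_left [simp]: "ip 0 w = 0"
  using ip_add_left[of 0 0 w] by simp

lemma ip_zero_right [simp]: "ip w 0 = 0"
  using ip_add_right[of w 0 0] by simp

lemma ip_minus_left: "ip (- v) w = - ip v w"
  using ip_add_left[of v "- v" w] by (simp add: eq_neg_iff_add_eq_0 add.commute)

lemma ip_minus_right: "ip w (- v) = - ip w v"
  using ip_add_right[of w v "- v"] by (simp add: eq_neg_iff_add_eq_0 add.commute)

lemma ip_diff_left: "ip (u - v) w = ip u w - ip v w"
  using ip_add_left[of u "- v" w] by (simp add: ip_minus_left)

lemma ip_diff_right: "ip w (u - v) = ip w u - ip w v"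
  using ip_add_right[of w u "- v"] by (simp add: ip_minus_right)

lemmas ip_simps = ip_add_left ip_add_right ip_diff_left ip_diff_right ip_scale_left ip_scale_right

lemma ip_eq_0_commute: "ip v w = 0 \<longleftrightarrow> ip w v = 0"
  using ip_commute[of v w] by simp

definition perp :: "'v set \<Rightarrow> 'v set" where
  "perp M = {v. \<forall>m\<in>M. ip v m = 0}"

lemma subspace_perp: "subspace (perp M)"
  unfolding perp_def by (rule subspaceI) (auto simp: ip_simps)

lemma perp_span: "perp (span B) = perp B"
proof
  show "perp (span B) \<subseteq> perp B"
    unfolding perp_def by (auto intro: span_base)
  show "perp B \<subseteq> perp (span B)"
  proof
    fix v assume v: "v \<in> perp B"
    have "ip v m = 0" if "m \<in> span B" for m
      using that v by (induction rule: span_induct_alt) (auto simp: ip_simps perp_def)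
    then show "v \<in> perp (span B)" by (simp add: perp_def)
  qed
qed

lemma perp_antimono: "M \<subseteq> N \<Longrightarrow> perp N \<subseteq> perp M"
  by (auto simp: perp_def)

text \<open>Gram-Schmidt: \<open>b1\<close> is the part of \<open>b\<close> orthogonal to
  \<open>span B\<close>, and the residual \<open>v - v0\<close> is corrected by a multiple of
  \<open>b1\<close>.\<close>

lemma orthogonal_projection_span:
  assumes "finite B"
  shows "\<exists>u\<in>span B. v - u \<in> perp (span B)"
  using assms
proof (induction arbitrary: v rule: finite_induct)
  case empty
  then show ?case by (auto simp: perp_def)
next
  case (insert b B)
  obtain b0 where b0: "b0 \<in> span B" "b - b0 \<in> perp (span B)"
    using insert.IH by blast
  obtain v0 where v0: "v0 \<in> span B" "v - v0 \<in> perp (span B)"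
    using insert.IH by blast
  define b1 where "b1 = b - b0"
  \<comment> \<open>If \<open>b\<close> already lies in \<open>span B\<close>, then
    \<open>b1 = 0\<close> and division by zero gives \<open>c = 0\<close>, so nothing is
    corrected.\<close>
  define c where "c = ip (v - v0) b1 / ip b1 b1"
  have sub: "span B \<subseteq> span (insert b B)" by (rule span_mono) auto
  have b1: "b1 \<in> span (insert b B)"
    unfolding b1_def using b0(1) sub by (intro span_diff[OF span_base]) auto
  have orth: "ip (v - v0 - c *s b1) m = 0" if "m \<in> span B" for m
    using that b0(2) v0(2) by (auto simp: perp_def b1_def ip_simps)
  have "ip (v - v0 - c *s b1) b1 = 0"
    using ip_self_eq_0[of b1] by (cases "b1 = 0") (auto simp: c_def ip_diff_left[of "v - v0"] ip_scale_left)
  then have "ip (v - v0 - c *s b1) b = 0"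
    using orth[OF b0(1)] by (simp add: b1_def ip_diff_right)
  then have "v - v0 - c *s b1 \<in> perp (span (insert b B))"
    unfolding perp_span using orth span_base by (auto simp: perp_def)
  then have "v - (v0 + c *s b1) \<in> perp (span (insert b B))"
    by (simp add: diff_diff_eq)
  moreover have "v0 + c *s b1 \<in> span (insert b B)"
    using v0(1) b1 sub by (intro span_add span_scale) blast
  ultimately show ?case by blast
qed

lemma orthogonal_projection:
  assumes "subspace U"
  obtains u where "u \<in> U" "v - u \<in> perp U"
proof -
  obtain B where B: "B \<subseteq> U" "independent B" "U \<subseteq> span B"
    by (rule basis_exists)
  then have "span B = U" "finite B"
    using assms finiteI_independent span_subspace by blast+
  then show ?thesis
    using that orthogonal_projection_span[of B v] by blast
qed

lemma perp_Int_self: "subspace U \<Longrightarrow> U \<inter> perp U = {0}"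
  by (auto simp: perp_def subspace_0 dest: ip_self_eq_0)

text \<open>For \<open>v\<close> in the double complement, the residual of its projection onto
  \<open>U\<close> lies in \<open>perp U\<close> and in the complement of \<open>perp U\<close>,
  hence vanishes.\<close>

lemma perp_perp:
  assumes "subspace U"
  shows "perp (perp U) = U"
proof
  show "U \<subseteq> perp (perp U)"
    unfolding perp_def using ip_eq_0_commute by blast
  show "perp (perp U) \<subseteq> U"
  proof
    fix v assume v: "v \<in> perp (perp U)"
    obtain u where u: "u \<in> U" "v - u \<in> perp U"
      using orthogonal_projection[OF assms] .
    have "u \<in> perp (perp U)"
      using u(1) unfolding perp_def using ip_eq_0_commute by blast
    then have "v - u \<in> perp (perp U)"
      using v by (intro subspace_diff[OF subspace_perp])
    then have "v - u = 0"
      using u(2) perp_Int_self[OF subspace_perp, of U] by blast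
    then show "v \<in> U" using u(1) by simp
  qed
qed

text \<open>Dualises modularity: the sums in the definition of a modular element become
  intersections of flats.\<close>

lemma perp_sum:
  assumes "subspace X" "subspace Y"
  shows "perp {x + y |x y. x \<in> X \<and> y \<in> Y} = perp X \<inter> perp Y"
proof -
  have "X \<subseteq> {x + y |x y. x \<in> X \<and> y \<in> Y}" "Y \<subseteq> {x + y |x y. x \<in> X \<and> y \<in> Y}"
    using subspace_0[OF assms(1)] subspace_0[OF assms(2)] by force+
  then have "perp {x + y |x y. x \<in> X \<and> y \<in> Y} \<subseteq> perp X \<inter> perp Y"
    by (intro Int_greatest perp_antimono)
  moreover have "perp X \<inter> perp Y \<subseteq> perp {x + y |x y. x \<in> X \<and> y \<in> Y}"
    by (auto simp: perp_def ip_simps)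
  ultimately show ?thesis by blast
qed

lemma perp_eq_iff:
  assumes "subspace U" "subspace V"
  shows "perp U = perp V \<longleftrightarrow> U = V"
  using assms perp_perp by metis

lemma perp_0 [simp]: "perp {0} = UNIV"
  by (simp add: perp_def)

lemma perp_UNIV [simp]: "perp UNIV = {0}"
  using perp_Int_self[OF subspace_UNIV] by simp

lemma dim_perp_singleton:
  assumes "a \<noteq> 0"
  shows "dim (perp {a}) + 1 = dim (UNIV :: 'v set)"
proof -
  have "a \<notin> perp {a}"
    using assms ip_self_eq_0 by (auto simp: perp_def)
  then have "dim (insert a (perp {a})) = dim (perp {a}) + 1"
    by (simp add: dim_insert span_eq_iff[THEN iffD2, OF subspace_perp])
  moreover have "v \<in> span (insert a (perp {a}))" for v
  proof -
    have "v - (ip v a / ip a a) *s a \<in> perp {a}"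
      using assms ip_self_eq_0 by (auto simp: perp_def ip_simps)
    then show ?thesis
      unfolding span_insert using span_base by blast
  qed
  then have "span (insert a (perp {a})) = UNIV" by blast
  then have "dim (insert a (perp {a})) = dim (UNIV :: 'v set)"
    by (metis dim_span)
  ultimately show ?thesis by simp
qed

lemma dim_perp:
  assumes "subspace U"
  shows "dim (perp U) + dim U = dim (UNIV :: 'v set)"
proof -
  have "v \<in> {x + y |x y. x \<in> perp U \<and> y \<in> U}" for v
  proof -
    obtain u where "u \<in> U" "v - u \<in> perp U"
      using orthogonal_projection[OF assms] .
    moreover have "v = (v - u) + u" by simp
    ultimately show ?thesis by blast
  qed
  then have "{x + y |x y. x \<in> perp U \<and> y \<in> U} = UNIV" by blast
  then show ?thesis
    using dim_sums_Int[OF subspace_perp assms, of U] perp_Int_self[OF assms]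
    by (simp add: Int_commute)
qed

end

section \<open>Roots and flats\<close>

text \<open>An injective affine self-map of a finite set permutes it and so preserves the sum of its
  elements. The conclusion is the fixed-point equation of the centroid, multiplied by
  \<open>card Z\<close>.\<close>

lemma affine_self_map_centroid:
  fixes Z :: "complex set"
  assumes "finite Z" "\<theta> \<noteq> 0" "\<And>z. z \<in> Z \<Longrightarrow> \<theta> * z + t \<in> Z"
  shows "(\<theta> - 1) * \<Sum>Z + of_nat (card Z) * t = 0"
proof -
  have inj: "inj_on (\<lambda>z. \<theta> * z + t) Z"
    using assms(2) by (auto simp: inj_on_def)
  then have "(\<lambda>z. \<theta> * z + t) ` Z = Z"
    using assms by (intro endo_inj_surj) auto
  then have "\<Sum>Z = (\<Sum>z\<in>Z. \<theta> * z + t)"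
    using sum.reindex[OF inj, of "\<lambda>z. z"] by simp
  also have "\<dots> = \<theta> * \<Sum>Z + of_nat (card Z) * t"
    by (simp add: sum.distrib sum_distrib_left)
  finally show ?thesis by (simp add: algebra_simps)
qed

context vector_space
begin

text \<open>The quotient of the span by \<open>M\<close> is at most a line, and \<open>y\<close> has
  nonzero image in it.\<close>

lemma span_insert_exchange:
  assumes M: "subspace M" and x: "x \<in> span (insert q M)" and y: "y \<in> span (insert q M)" "y \<notin> M"
  obtains c where "x - c *s y \<in> M"
proof -
  obtain i j where i: "x - i *s q \<in> M" and j: "y - j *s q \<in> M"
    using x y(1) M by (auto simp: span_insert span_eq_iff[THEN iffD2])
  have "j \<noteq> 0" using j y(2) by auto
  then have "x - (i / j) *s y = (x - i *s q) - (i / j) *s (y - j *s q)"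
    by (simp add: algebra_simps)
  then have "x - (i / j) *s y \<in> M"
    using i j M by (metis subspace_diff subspace_scale)
  then show ?thesis by (rule that)
qed

lemma subspace_scale_cancel:
  assumes "subspace M" "c *s p \<in> M" "p \<notin> M"
  shows "c = 0"
proof (rule ccontr)
  assume "c \<noteq> 0"
  then have "p = (1 / c) *s (c *s p)" by simp
  then show False using assms by (metis subspace_scale)
qed

end

section \<open>Roots of a finite unitary group\<close>

locale unitary_group = hermitian_space scale Basis ip
  for scale :: "complex \<Rightarrow> 'v::ab_group_add \<Rightarrow> 'v" (infixr "*s" 75) and Basis :: "'v set"
    and ip :: "'v \<Rightarrow> 'v \<Rightarrow> complex" +
  fixes W :: "('v \<Rightarrow> 'v) set"
  assumes finite_W: "finite W"
    and W_linear: "g \<in> W \<Longrightarrow> Vector_Spaces.linear scale scale g"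
    and W_comp: "g \<in> W \<Longrightarrow> h \<in> W \<Longrightarrow> g \<circ> h \<in> W"
    and W_inverse: "g \<in> W \<Longrightarrow> \<exists>h\<in>W. h \<circ> g = id \<and> g \<circ> h = id"
    and W_ip: "g \<in> W \<Longrightarrow> ip (g v) (g w) = ip v w"
begin

text \<open>The formula is a unitary reflection with hyperplane \<open>perp {a}\<close>. The factor
  \<open>k\<close> absorbs the length of \<open>a\<close> and the eigenvalue on it, so roots form a
  union of punctured lines.\<close>

definition roots :: "'v set" where
  "roots = {a. a \<noteq> 0 \<and> (\<exists>g\<in>W. \<exists>k. k \<noteq> 0 \<and> (\<forall>v. g v = v - (k * ip v a) *s a))}"

lemma root_reflection:
  assumes "a \<in> roots"
  obtains g k where "g \<in> W" "k \<noteq> 0" "\<forall>v. g v = v - (k * ip v a) *s a"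
  using assms by (auto simp: roots_def)

lemma root_nonzero: "a \<in> roots \<Longrightarrow> a \<noteq> 0"
  by (simp add: roots_def)

lemma ip_root_self: "a \<in> roots \<Longrightarrow> ip a a \<noteq> 0"
  using ip_self_eq_0 root_nonzero by blast

lemma roots_scale:
  assumes "a \<in> roots" "c \<noteq> 0"
  shows "c *s a \<in> roots"
proof -
  obtain g k where g: "g \<in> W" "k \<noteq> 0" "\<forall>v. g v = v - (k * ip v a) *s a"
    using root_reflection[OF assms(1)] .
  have "g v = v - (k / (c * cnj c) * ip v (c *s a)) *s (c *s a)" for v
    using assms(2) by (simp add: g(3) ip_scale_right)
  moreover have "k / (c * cnj c) \<noteq> 0" using g(2) assms(2) by simp
  moreover have "c *s a \<noteq> 0" using root_nonzero[OF assms(1)] assms(2) by simp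
  ultimately show ?thesis
    using g(1) unfolding roots_def by blast
qed

lemma W_add: "g \<in> W \<Longrightarrow> g (v + w) = g v + g w"
  using W_linear Vector_Spaces.linear_iff by blast

lemma W_scale: "g \<in> W \<Longrightarrow> g (c *s v) = c *s g v"
  using W_linear Vector_Spaces.linear_iff by blast

lemma W_diff: "g \<in> W \<Longrightarrow> g (v - w) = g v - g w"
  using W_add[of g "v - w" w] by simp

lemma W_obtain_inverse:
  assumes "g \<in> W"
  obtains h where "h \<in> W" "\<forall>v. h (g v) = v" "\<forall>v. g (h v) = v"
  using W_inverse[OF assms] by (auto simp: fun_eq_iff)

text \<open>Conjugating the reflection in \<open>a\<close> by \<open>w\<close> gives the reflection
  in \<open>w a\<close> with the same \<open>k\<close>.\<close>

lemma roots_image: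
  assumes "w \<in> W" "a \<in> roots"
  shows "w a \<in> roots"
proof -
  obtain g k where g: "g \<in> W" "k \<noteq> 0" "\<forall>v. g v = v - (k * ip v a) *s a"
    using root_reflection[OF assms(2)] .
  obtain w' where w': "w' \<in> W" "\<forall>v. w' (w v) = v" "\<forall>v. w (w' v) = v"
    using W_obtain_inverse[OF assms(1)] .
  have "ip (w' v) a = ip v (w a)" for v
    using W_ip[OF assms(1), of "w' v" a] w'(3) by simp
  then have "(w \<circ> (g \<circ> w')) v = v - (k * ip v (w a)) *s w a" for v
    by (simp add: g(3) W_diff[OF assms(1)] W_scale[OF assms(1)] w'(3))
  moreover have "w \<circ> (g \<circ> w') \<in> W"
    using assms(1) g(1) w'(1) W_comp by blast
  moreover have "w a \<noteq> 0"
    using ip_root_self[OF assms(2)] W_ip[OF assms(1), of a a] by auto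
  ultimately show ?thesis
    using g(2) unfolding roots_def by blast
qed

section \<open>Flats and modular flats\<close>

definition flat :: "'v set \<Rightarrow> bool" where
  "flat F \<longleftrightarrow> (\<exists>B\<subseteq>roots. F = span B)"

definition modular_flat :: "'v set \<Rightarrow> bool" where
  "modular_flat M \<longleftrightarrow> flat M \<and> (\<forall>F. flat F \<longrightarrow> flat (F \<inter> M))"

lemma flat_subspace: "flat F \<Longrightarrow> subspace F"
  by (auto simp: flat_def)

lemma flatI:
  assumes "subspace F" "F \<subseteq> span (F \<inter> roots)"
  shows "flat F"
proof -
  have "span (F \<inter> roots) \<subseteq> F" using assms(1) by (intro span_minimal) auto
  then show ?thesis using assms(2) by (auto simp: flat_def intro!: exI[of _ "F \<inter> roots"])
qed

lemma flat_eq_span_roots: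
  assumes "flat F"
  shows "span (F \<inter> roots) = F"
proof
  obtain B where "B \<subseteq> roots" "F = span B" using assms by (auto simp: flat_def)
  then show "F \<subseteq> span (F \<inter> roots)" using span_superset by (auto intro!: span_mono)
  show "span (F \<inter> roots) \<subseteq> F"
    using flat_subspace[OF assms] by (intro span_minimal) auto
qed

lemma flat_subset_roots:
  assumes "flat F" "subspace U" "F \<inter> roots \<subseteq> U"
  shows "F \<subseteq> U"
  using span_minimal[OF assms(3,2)] flat_eq_span_roots[OF assms(1)] by simp

lemma flat_span_insert:
  assumes "flat F" "r \<in> roots"
  shows "flat (span (insert r F))"
proof -
  obtain B where B: "B \<subseteq> roots" "F = span B" using assms(1) by (auto simp: flat_def)
  have "span (insert r F) = span (insert r B)"
    unfolding B(2) span_insert span_span ..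
  then show ?thesis using B(1) assms(2) unfolding flat_def by blast
qed

lemma root_if_flat_line:
  assumes "flat (span {p})" "p \<noteq> 0"
  shows "p \<in> roots"
proof -
  have "\<not> span {p} \<inter> roots \<subseteq> {0}"
    using flat_subset_roots[OF assms(1), of "{0}"] assms(2) span_base[of p "{p}"] by auto
  then obtain c where c: "c *s p \<in> roots"
    by (auto simp: span_singleton)
  then have "c \<noteq> 0" using root_nonzero by force
  then show ?thesis using roots_scale[OF c, of "1 / c"] by simp
qed

text \<open>Conjugates of flats are written as preimages, so that membership is just
  \<open>g v \<in> F\<close>; the inverse \<open>h\<close> turns them into images, which commute
  with spans.\<close>

lemma flat_vimage:
  assumes "g \<in> W" "flat F"
  shows "flat (g -` F)"
proof -
  obtain B where B: "B \<subseteq> roots" "F = span B" using assms(2) by (auto simp: flat_def)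
  obtain h where h: "h \<in> W" "\<forall>v. h (g v) = v" "\<forall>v. g (h v) = v"
    using W_obtain_inverse[OF assms(1)] .
  interpret h: Vector_Spaces.linear scale scale h by (rule W_linear[OF h(1)])
  have "g -` F = h ` F"
  proof (intro equalityI subsetI)
    fix x assume "x \<in> g -` F"
    then have "h (g x) \<in> h ` F" by blast
    then show "x \<in> h ` F" by (simp add: h(2))
  qed (auto simp: h(3))
  also have "\<dots> = span (h ` B)"
    by (simp add: B(2) h.span_image)
  finally have "g -` F = span (h ` B)" .
  moreover have "h ` B \<subseteq> roots" using B(1) roots_image[OF h(1)] by auto
  ultimately show ?thesis unfolding flat_def by (intro exI[of _ "h ` B"]) simp
qed

lemma modular_flat_vimage:
  assumes g: "g \<in> W" and M: "modular_flat M"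
  shows "modular_flat (g -` M)"
  unfolding modular_flat_def
proof (intro conjI allI impI)
  show "flat (g -` M)" using M flat_vimage[OF g] by (simp add: modular_flat_def)
  fix F assume F: "flat F"
  obtain h where h: "h \<in> W" "\<forall>v. h (g v) = v" "\<forall>v. g (h v) = v"
    using W_obtain_inverse[OF g] .
  have "flat (h -` F \<inter> M)"
    using M flat_vimage[OF h(1) F] by (simp add: modular_flat_def)
  then have "flat (g -` (h -` F \<inter> M))" by (rule flat_vimage[OF g])
  then show "flat (F \<inter> g -` M)" by (simp add: vimage_def Int_def h(2))
qed

lemma modular_flat_flat: "modular_flat M \<Longrightarrow> flat M"
  by (simp add: modular_flat_def)

lemma modular_flat_subspace: "modular_flat M \<Longrightarrow> subspace M"
  by (simp add: modular_flat_def flat_subspace)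

text \<open>For \<open>v\<close> in \<open>M\<close>, the difference \<open>v - g v\<close> is a
  multiple of \<open>q\<close>, which is not in \<open>M\<close>; so \<open>g v\<close> stays in
  \<open>M\<close> only if \<open>v\<close> is orthogonal to \<open>q\<close>. The section is
  therefore the intersection of \<open>M\<close> with its mirror image, a flat by
  modularity.\<close>

lemma modular_flat_Int_perp_root:
  assumes M: "modular_flat M" and q: "q \<in> roots" "q \<notin> M"
  shows "flat (M \<inter> perp {q})"
proof -
  obtain g k where g: "g \<in> W" "k \<noteq> 0" "\<forall>v. g v = v - (k * ip v q) *s q"
    using root_reflection[OF q(1)] .
  have "v \<in> g -` M \<longleftrightarrow> v \<in> perp {q}" if v: "v \<in> M" for v
  proof
    assume "v \<in> g -` M"
    then have "v - g v \<in> M"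
      using v modular_flat_subspace[OF M] by (auto intro: subspace_diff)
    then have "(k * ip v q) *s q \<in> M" by (simp add: g(3))
    then have "k * ip v q = 0"
      using subspace_scale_cancel modular_flat_subspace[OF M] q(2) by blast
    then show "v \<in> perp {q}" using g(2) by (simp add: perp_def)
  next
    assume "v \<in> perp {q}"
    then show "v \<in> g -` M" using v by (simp add: perp_def g(3))
  qed
  then have "M \<inter> perp {q} = M \<inter> g -` M" by blast
  then show ?thesis
    using modular_flat_vimage[OF g(1) M] modular_flat_flat[OF M] by (simp add: modular_flat_def)
qed

text \<open>The vectors \<open>a + z *s b\<close> span pairwise distinct lines, so their reflections
  are pairwise distinct elements of the finite \<open>W\<close>.\<close>

lemma finite_root_translates:
  assumes "a \<notin> span {b}" "b \<noteq> 0"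
  shows "finite {z. a + z *s b \<in> roots}"
proof -
  have "\<forall>z\<in>{z. a + z *s b \<in> roots}. \<exists>g. g \<in> W \<and>
      (\<exists>k. k \<noteq> 0 \<and> (\<forall>v. g v = v - (k * ip v (a + z *s b)) *s (a + z *s b)))"
    unfolding roots_def by blast
  from bchoice[OF this] obtain G where G: "\<forall>z\<in>{z. a + z *s b \<in> roots}. G z \<in> W \<and>
      (\<exists>k. k \<noteq> 0 \<and> (\<forall>v. G z v = v - (k * ip v (a + z *s b)) *s (a + z *s b)))" ..
  have "inj_on G {z. a + z *s b \<in> roots}"
  proof (rule inj_onI)
    fix z y assume z: "z \<in> {z. a + z *s b \<in> roots}" and y: "y \<in> {z. a + z *s b \<in> roots}" and eq: "G z = G y"
    let ?z = "a + z *s b" and ?y = "a + y *s b"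
    obtain k where k: "k \<noteq> 0" "\<And>v. G z v = v - (k * ip v ?z) *s ?z" using G z by blast
    obtain l where l: "l \<noteq> 0" "\<And>v. G y v = v - (l * ip v ?y) *s ?y" using G y by blast
    have "(k * ip ?z ?z) *s ?z = (l * ip ?z ?y) *s ?y"
      using k(2)[of ?z] l(2)[of ?z] eq by simp
    moreover define c where "c = k * ip ?z ?z"
    moreover define d where "d = l * ip ?z ?y"
    ultimately have "c *s ?z = d *s ?y" by simp
    then have cd: "(c - d) *s a = (d * y - c * z) *s b"
      by (simp add: algebra_simps)
    have c0: "c \<noteq> 0" using k(1) z ip_root_self by (simp add: c_def)
    have "c = d"
    proof (rule ccontr)
      assume "c \<noteq> d"
      then have "a = ((d * y - c * z) / (c - d)) *s b"
        using arg_cong[OF cd, of "\<lambda>v. (1 / (c - d)) *s v"] by simp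
      then show False using assms(1) by (auto simp: span_singleton)
    qed
    then have "(c * y - c * z) *s b = 0" using cd by simp
    then show "z = y" using c0 assms(2) by auto
  qed
  moreover have "G ` {z. a + z *s b \<in> roots} \<subseteq> W" using G by auto
  ultimately show ?thesis using finite_W by (meson finite_imageD finite_subset)
qed

text \<open>Both the map \<open>v \<mapsto> v + \<phi> v \<cdot> b\<close> and the unitary reflection with root \<open>b\<close> act by affine
  maps on the finite set of all \<open>z\<close> for which \<open>a + z b\<close> is a root, so both fix its centroid.
  Hence the two maps have the same fixed hyperplane.\<close>

lemma root_preserving_homology:
  assumes M: "subspace M" and b: "b \<in> roots" "b \<in> M" and a: "a \<in> roots" "a \<in> M"
    and add: "\<And>u v. \<phi> (u + v) = \<phi> u + \<phi> v" and scale: "\<And>c v. \<phi> (c *s v) = c * \<phi> v"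
    and pres: "\<And>r. r \<in> roots \<Longrightarrow> r \<in> M \<Longrightarrow> r + \<phi> r *s b \<in> roots"
  shows "\<phi> a * ip b b = ip a b * \<phi> b"
proof (cases "a \<in> span {b}")
  case True
  then show ?thesis by (auto simp: span_singleton scale ip_simps)
next
  case False
  define Z where "Z = {z. a + z *s b \<in> roots}"
  have fin: "finite Z"
    unfolding Z_def using False root_nonzero[OF b(1)] by (rule finite_root_translates)
  have "0 \<in> Z" using a by (simp add: Z_def)
  then have card: "card Z \<noteq> 0" using fin by auto
  \<comment> \<open>One \<open>\<psi>\<close> covers both maps: \<open>\<phi>\<close> itself and the
    reflection in \<open>b\<close>, where \<open>\<psi> v = - (k * ip v b)\<close>.\<close>
  have key: "\<psi> b * \<Sum>Z + of_nat (card Z) * \<psi> a = 0"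
    if add: "\<And>u v. \<psi> (u + v) = \<psi> u + \<psi> v" and scale: "\<And>c v. \<psi> (c *s v) = c * \<psi> v"
      and pres: "\<And>r. r \<in> roots \<Longrightarrow> r \<in> M \<Longrightarrow> r + \<psi> r *s b \<in> roots" for \<psi> :: "'v \<Rightarrow> complex"
  proof -
    \<comment> \<open>The image of \<open>b\<close> is a root, so the slope
      \<open>1 + \<psi> b\<close> of the affine map on \<open>Z\<close> is nonzero.\<close>
    have "(1 + \<psi> b) *s b \<in> roots"
      using pres[OF b] by (simp add: scale_left_distrib)
    then have "1 + \<psi> b \<noteq> 0" using root_nonzero by force
    moreover have "(1 + \<psi> b) * z + \<psi> a \<in> Z" if "z \<in> Z" for z
    proof -
      have "a + z *s b \<in> M" using a(2) b(2) M by (intro subspace_add subspace_scale)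
      then have "(a + z *s b) + \<psi> (a + z *s b) *s b \<in> roots"
        using that pres by (simp add: Z_def)
      moreover have "(a + z *s b) + \<psi> (a + z *s b) *s b = a + ((1 + \<psi> b) * z + \<psi> a) *s b"
        by (simp add: add scale algebra_simps)
      ultimately show ?thesis by (simp add: Z_def)
    qed
    ultimately show ?thesis
      using affine_self_map_centroid[OF fin, of "1 + \<psi> b" "\<psi> a"] by simp
  qed
  obtain g k where g: "g \<in> W" "k \<noteq> 0" "\<forall>v. g v = v - (k * ip v b) *s b"
    using root_reflection[OF b(1)] .
  have "(- (k * ip b b)) * \<Sum>Z + of_nat (card Z) * (- (k * ip a b)) = 0"
    by (rule key) (use roots_image[OF g(1)] in \<open>auto simp: ip_simps g(3) algebra_simps\<close>)
  then have "- (k * (ip b b * \<Sum>Z + of_nat (card Z) * ip a b)) = 0"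
    by (simp add: ring_distribs mult_ac)
  then have 1: "ip b b * \<Sum>Z + of_nat (card Z) * ip a b = 0" using g(2) by simp
  have 2: "\<phi> b * \<Sum>Z + of_nat (card Z) * \<phi> a = 0"
    by (rule key[OF add scale pres])
  \<comment> \<open>Eliminating \<open>\<Sum>Z\<close> from the two centroid equations leaves
    \<open>card Z\<close> times the claim.\<close>
  have "of_nat (card Z) * (\<phi> a * ip b b - ip a b * \<phi> b) =
      (\<phi> b * \<Sum>Z + of_nat (card Z) * \<phi> a) * ip b b - (ip b b * \<Sum>Z + of_nat (card Z) * ip a b) * \<phi> b"
    by (simp add: algebra_simps)
  also have "\<dots> = 0" unfolding 1 2 by simp
  finally show ?thesis using card by simp
qed

end

section \<open>Connectedness and projection from a skew point\<close>

text \<open>Irreducibility is phrased through roots: a reflection preserves \<open>U\<close> exactly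
  when its root lies in \<open>U\<close> or in \<open>perp U\<close>.\<close>

locale irreducible_reflection_group = unitary_group scale Basis ip W
  for scale :: "complex \<Rightarrow> 'v::ab_group_add \<Rightarrow> 'v" (infixr "*s" 75) and Basis :: "'v set"
    and ip :: "'v \<Rightarrow> 'v \<Rightarrow> complex" and W :: "('v \<Rightarrow> 'v) set" +
  assumes irreducible:
    "subspace U \<Longrightarrow> (\<And>a. a \<in> roots \<Longrightarrow> a \<in> U \<or> a \<in> perp U) \<Longrightarrow> U = {0} \<or> U = UNIV"
begin

text \<open>If some \<open>u\<close> in \<open>U\<close> is not orthogonal to \<open>a\<close>, then
  \<open>u - g u\<close> is a nonzero multiple of \<open>a\<close> inside \<open>U\<close>.\<close>

lemma root_in_or_perp_invariant:
  assumes U: "subspace U" and g: "\<forall>v. g v = v - (k * ip v a) *s a" "k \<noteq> 0"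
    and inv: "\<And>u. u \<in> U \<Longrightarrow> g u \<in> U"
  shows "a \<in> U \<or> a \<in> perp U"
proof (rule ccontr)
  assume *: "\<not> (a \<in> U \<or> a \<in> perp U)"
  then obtain u where u: "u \<in> U" "ip a u \<noteq> 0" by (auto simp: perp_def)
  have "u - g u \<in> U" using U u(1) inv by (intro subspace_diff)
  then have "(k * ip u a) *s a \<in> U" by (simp add: g(1))
  then have "k * ip u a = 0" using subspace_scale_cancel[OF U] * by blast
  then show False using u(2) g(2) by (simp add: ip_eq_0_commute)
qed

text \<open>The roots not orthogonal to \<open>a\<close> span everything by irreducibility, so
  \<open>b\<close> cannot be orthogonal to all of them.\<close>

lemma root_not_orthogonal_to_two:
  assumes a: "a \<in> roots" and b: "b \<noteq> 0"
  obtains q where "q \<in> roots" "ip q a \<noteq> 0" "ip q b \<noteq> 0"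
proof -
  define Q where "Q = {q \<in> roots. ip q a \<noteq> 0}"
  have "r \<in> span Q \<or> r \<in> perp (span Q)" if r: "r \<in> roots" for r
  proof (cases "ip r a = 0")
    case False
    then show ?thesis using r by (auto simp: Q_def intro: span_base)
  next
    case True
    obtain g k where g: "g \<in> W" "k \<noteq> 0" "\<forall>v. g v = v - (k * ip v r) *s r"
      using root_reflection[OF r] .
    \<comment> \<open>As \<open>r\<close> is orthogonal to \<open>a\<close>, its reflection does not
      change \<open>ip q a\<close>.\<close>
    have "g q \<in> Q" if "q \<in> Q" for q
      using that roots_image[OF g(1)] True by (auto simp: Q_def g(3) ip_simps)
    then have gQ: "g ` Q \<subseteq> Q" by blast
    interpret g: Vector_Spaces.linear scale scale g by (rule W_linear[OF g(1)])
    have "g ` span Q \<subseteq> span Q"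
      using g.span_image[of Q] span_mono[OF gQ] by simp
    then show ?thesis
      by (intro root_in_or_perp_invariant[OF _ g(3,2)]) auto
  qed
  then have "span Q = {0} \<or> span Q = UNIV"
    by (intro irreducible) auto
  moreover have "a \<in> span Q"
    using a ip_root_self by (auto simp: Q_def intro: span_base)
  ultimately have "span Q = UNIV" using root_nonzero[OF a] by auto
  have "b \<notin> perp Q"
  proof
    assume "b \<in> perp Q"
    then have "b \<in> perp (span Q)" by (simp add: perp_span)
    then show False using \<open>span Q = UNIV\<close> b by simp
  qed
  then obtain q where "q \<in> Q" "ip b q \<noteq> 0" by (auto simp: perp_def)
  then show ?thesis using that[of q] ip_eq_0_commute[of b q] by (auto simp: Q_def)
qed

text \<open>A root \<open>q\<close> orthogonal to neither \<open>a\<close> nor \<open>b\<close> lies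
  outside \<open>M\<close>, so \<open>M \<inter> perp {q}\<close> is a flat. Its roots split along
  \<open>U\<close> and \<open>perp U\<close>, hence so do all its vectors; but a combination of
  \<open>a\<close> and \<open>b\<close> orthogonal to \<open>q\<close> has components that are
  not.\<close>

lemma modular_flat_roots_connected:
  assumes M: "modular_flat M" and U: "subspace U"
    and split: "\<And>r. r \<in> roots \<Longrightarrow> r \<in> M \<Longrightarrow> r \<in> U \<or> r \<in> perp U"
    and a: "a \<in> roots" "a \<in> M" "a \<in> U" and b: "b \<in> roots" "b \<in> M" "b \<in> perp U"
  shows False
proof -
  obtain q where q: "q \<in> roots" "ip q a \<noteq> 0" "ip q b \<noteq> 0"
    using root_not_orthogonal_to_two[OF a(1) root_nonzero[OF b(1)]] .
  have "q \<notin> U" using q(3) b(3) ip_eq_0_commute[of b q] by (auto simp: perp_def)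
  moreover have "q \<notin> perp U" using q(2) a(3) by (auto simp: perp_def)
  ultimately have "q \<notin> M" using split q(1) by blast
  then have fl: "flat (M \<inter> perp {q})"
    using modular_flat_Int_perp_root[OF M q(1)] by blast
  let ?A = "U \<inter> perp {q}" and ?B = "perp U \<inter> perp {q}"
  let ?S = "{x + y |x y. x \<in> ?A \<and> y \<in> ?B}"
  have sA: "subspace ?A" and sB: "subspace ?B"
    using U subspace_perp by (auto intro: subspace_inter)
  then have "subspace ?S" by (rule subspace_sums)
  moreover have "M \<inter> perp {q} \<inter> roots \<subseteq> ?S"
  proof
    fix r assume "r \<in> M \<inter> perp {q} \<inter> roots"
    then have "r \<in> ?A \<or> r \<in> ?B" using split by auto
    then show "r \<in> ?S"
    proof
      assume "r \<in> ?A"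
      moreover have "r = r + 0" by simp
      ultimately show ?thesis using subspace_0[OF sB] by blast
    next
      assume "r \<in> ?B"
      moreover have "r = 0 + r" by simp
      ultimately show ?thesis using subspace_0[OF sA] by blast
    qed
  qed
  ultimately have sub: "M \<inter> perp {q} \<subseteq> ?S" by (rule flat_subset_roots[OF fl])
  define c where "c = ip a q / ip b q"
  have bq: "ip b q \<noteq> 0" using q(3) ip_eq_0_commute[of b q] by simp
  have "a - c *s b \<in> M"
    using modular_flat_subspace[OF M] a(2) b(2) by (intro subspace_diff subspace_scale)
  moreover have "ip (a - c *s b) q = 0" using bq by (simp add: ip_simps c_def)
  ultimately have "a - c *s b \<in> ?S" using sub by (auto simp: perp_def)
  then obtain x y where xy: "a - c *s b = x + y" "x \<in> ?A" "y \<in> ?B" by blast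
  \<comment> \<open>Both sides lie in complementary subspaces, so \<open>x = a\<close>, although
    \<open>x\<close> is orthogonal to \<open>q\<close>.\<close>
  have "a - x = y + c *s b" using xy(1) by (simp add: algebra_simps)
  moreover have "a - x \<in> U" using a(3) xy(2) U by (intro subspace_diff) auto
  moreover have "y + c *s b \<in> perp U"
    using b(3) xy(3) by (intro subspace_add subspace_scale subspace_perp) auto
  ultimately have "a - x = 0" using perp_Int_self[OF U] by auto
  then have "ip a q = 0" using xy(2) by (simp add: perp_def)
  then show False using q(2) ip_eq_0_commute[of a q] by simp
qed

lemma modular_flat_no_split:
  assumes M: "modular_flat M" and U: "subspace U"
    and split: "\<And>r. r \<in> roots \<Longrightarrow> r \<in> M \<Longrightarrow> r \<in> U \<or> r \<in> perp U"
  shows "M \<subseteq> U \<or> M \<subseteq> perp U"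
proof (rule ccontr)
  assume "\<not> ?thesis"
  then have "\<not> M \<inter> roots \<subseteq> U" "\<not> M \<inter> roots \<subseteq> perp U"
    using flat_subset_roots[OF modular_flat_flat[OF M]] U subspace_perp by blast+
  then obtain a b where "a \<in> M" "a \<in> roots" "a \<notin> perp U" "b \<in> M" "b \<in> roots" "b \<notin> U" by blast
  then show False
    using modular_flat_roots_connected[OF M U split, of a b] split[of a] split[of b] by blast
qed

end

text \<open>\<open>N_span\<close> says that \<open>M\<close> has codimension one in \<open>N\<close>
  without singling out a vector, so the locale can be instantiated with each conjugate of
  \<open>M\<close> inside \<open>N\<close>.\<close>

locale skew_point = irreducible_reflection_group scale Basis ip W
  for scale :: "complex \<Rightarrow> 'v::ab_group_add \<Rightarrow> 'v" (infixr "*s" 75) and Basis :: "'v set"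
    and ip :: "'v \<Rightarrow> 'v \<Rightarrow> complex" and W :: "('v \<Rightarrow> 'v) set" +
  fixes M N F :: "'v set" and p :: 'v
  assumes M: "modular_flat M" and F: "flat F" and F_Int_N: "F \<inter> N = span {p}"
    and p_notin_M: "p \<notin> M" and p_not_root: "p \<notin> roots"
    and N_span: "x \<in> N \<Longrightarrow> y \<in> N \<Longrightarrow> y \<notin> M \<Longrightarrow> \<exists>c. x - c *s y \<in> M"
    and N_subspace: "subspace N" and M_subset_N: "M \<subseteq> N"
begin

lemma M_subspace: "subspace M"
  by (rule modular_flat_subspace[OF M])

lemma p_in_F: "p \<in> F" and p_in_N: "p \<in> N"
  using F_Int_N span_base[of p "{p}"] by auto

text \<open>For \<open>r\<close> outside \<open>M\<close>, the flat spanned by \<open>F\<close> and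
  \<open>r\<close> meets \<open>M\<close> exactly in the line of the projection \<open>m\<close>,
  which modularity makes a flat. It is nonzero because \<open>p\<close> is not proportional to a
  root.\<close>

lemma projection_root:
  assumes r: "r \<in> roots" "r \<in> N"
  obtains c where "r - c *s p \<in> M" "r - c *s p \<in> roots"
proof (cases "r \<in> M")
  case True
  then show ?thesis using that[of 0] r by simp
next
  case False
  obtain c where c: "r - c *s p \<in> M"
    using N_span[OF r(2) p_in_N p_notin_M] by blast
  define m where "m = r - c *s p"
  have mM: "m \<in> M" using c by (simp add: m_def)
  have "c \<noteq> 0" using c False by auto
  have "m \<noteq> 0"
  proof
    assume "m = 0"
    then have "p = (1 / c) *s r" using \<open>c \<noteq> 0\<close> by (simp add: m_def)
    then show False using roots_scale[OF r(1), of "1 / c"] \<open>c \<noteq> 0\<close> p_not_root by simp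
  qed
  have "span (insert r F) \<inter> M = span {m}"
  proof
    show "span (insert r F) \<inter> M \<subseteq> span {m}"
    proof
      fix x assume x: "x \<in> span (insert r F) \<inter> M"
      then obtain k where k: "x - k *s r \<in> F"
        using flat_subspace[OF F] by (auto simp: span_insert span_eq_iff[THEN iffD2])
      have "x - k *s r \<in> N"
        using x M_subset_N r(2) N_subspace by (intro subspace_diff subspace_scale) auto
      \<comment> \<open>\<open>F\<close> meets \<open>N\<close> only in the line of
        \<open>p\<close>.\<close>
      then obtain j where j: "x - k *s r = j *s p"
        using k F_Int_N by (auto simp: span_singleton)
      have e: "x = k *s m + (k * c + j) *s p"
        using j by (simp add: m_def algebra_simps)
      have "x - k *s m \<in> M"
        using x mM M_subspace by (intro subspace_diff subspace_scale) auto
      then have "(k * c + j) *s p \<in> M" using e by simp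
      then have "k * c + j = 0" using subspace_scale_cancel[OF M_subspace] p_notin_M by blast
      then show "x \<in> span {m}" using e by (auto simp: span_singleton)
    qed
    have "m \<in> span (insert r F)"
      unfolding m_def by (intro span_diff span_scale span_base) (auto simp: p_in_F)
    then show "span {m} \<subseteq> span (insert r F) \<inter> M"
      using mM M_subspace by (intro span_minimal) (auto intro: subspace_inter)
  qed
  moreover have "flat (span (insert r F) \<inter> M)"
    using M flat_span_insert[OF F r(1)] by (simp add: modular_flat_def)
  ultimately have "m \<in> roots" using root_if_flat_line \<open>m \<noteq> 0\<close> by simp
  then show ?thesis using that[of c] c by (simp add: m_def)
qed

text \<open>Reflecting \<open>v\<close> in \<open>q\<close> and projecting from \<open>p\<close>
  gives \<open>v - (k * ip v q) *s b\<close>, a root-preserving homology of \<open>M\<close>. The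
  conclusion says that the orthogonal projection of \<open>q\<close> to \<open>M\<close> is a
  multiple of \<open>b\<close>.\<close>

lemma projection_root_proportional:
  assumes q: "q \<in> roots" "q \<in> N" and c: "q - c *s p \<in> M" "q - c *s p \<in> roots" and v: "v \<in> M"
  defines "b \<equiv> q - c *s p"
  shows "ip v q * ip b b = ip v b * ip b q"
proof -
  obtain g k where g: "g \<in> W" "k \<noteq> 0" "\<forall>v. g v = v - (k * ip v q) *s q"
    using root_reflection[OF q(1)] .
  have bM: "b \<in> M" and br: "b \<in> roots" using c by (simp_all add: b_def)
  have pres: "r + (- k * ip r q) *s b \<in> roots" if r: "r \<in> roots" "r \<in> M" for r
  proof -
    have gr: "g r \<in> roots" by (rule roots_image[OF g(1) r(1)])
    have "g r \<in> N"
      using r(2) M_subset_N q(2) N_subspace unfolding g(3)[rule_format]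
      by (intro subspace_diff subspace_scale) auto
    then obtain d where d: "g r - d *s p \<in> M" "g r - d *s p \<in> roots"
      using projection_root[OF gr] by blast
    define x where "x = r + (- k * ip r q) *s b"
    have "x \<in> M" unfolding x_def using r(2) bM M_subspace by (intro subspace_add subspace_scale)
    have e: "g r - d *s p = x + (- k * ip r q * c - d) *s p"
      by (simp add: x_def g(3) b_def algebra_simps)
    then have "(- k * ip r q * c - d) *s p = (g r - d *s p) - x" by simp
    then have "(- k * ip r q * c - d) *s p \<in> M"
      using d(1) \<open>x \<in> M\<close> M_subspace by (metis subspace_diff)
    \<comment> \<open>As \<open>p\<close> is outside \<open>M\<close>, the components along
      \<open>p\<close> cancel and the projected root is exactly \<open>x\<close>.\<close>
    then have "- k * ip r q * c - d = 0"
      using subspace_scale_cancel[OF M_subspace] p_notin_M by blast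
    then show ?thesis using d(2) e by (simp add: x_def)
  qed
  have root: "ip a q * ip b b = ip a b * ip b q" if a: "a \<in> roots" "a \<in> M" for a
  proof -
    have "(- k * ip a q) * ip b b = ip a b * (- k * ip b q)"
      by (rule root_preserving_homology[OF M_subspace br bM a, of "\<lambda>v. - k * ip v q"])
        (use pres in \<open>auto simp: ip_simps algebra_simps\<close>)
    then show ?thesis using g(2) by simp
  qed
  have "v \<in> span (M \<inter> roots)" using v flat_eq_span_roots[OF modular_flat_flat[OF M]] by simp
  then show ?thesis
  proof (induction rule: span_induct_alt)
    case base
    then show ?case by simp
  next
    case (step d x y)
    then have "ip x q * ip b b = ip x b * ip b q" using root by blast
    then show ?case using step.IH by (simp add: ip_simps distrib_right)
  qed
qed

text \<open>Since \<open>q\<close> is outside \<open>M\<close>, \<open>c\<close> is nonzero and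
  \<open>p\<close> is a combination of \<open>q\<close> and \<open>b\<close>; so \<open>p\<close>,
  too, projects orthogonally to a multiple of \<open>b\<close>.\<close>

lemma projection_root_proportional':
  assumes q: "q \<in> roots" "q \<in> N" "q \<notin> M" and c: "q - c *s p \<in> M" "q - c *s p \<in> roots" and v: "v \<in> M"
  defines "b \<equiv> q - c *s p"
  shows "ip v p * ip b b = ip v b * ip b p"
proof -
  have c0: "c \<noteq> 0" using c(1) q(3) by auto
  have "q = b + c *s p" by (simp add: b_def)
  then have "(ip v b + cnj c * ip v p) * ip b b = ip v b * (ip b b + cnj c * ip b p)"
    using projection_root_proportional[OF q(1,2) c v, folded b_def] by (simp add: ip_simps)
  then have "cnj c * (ip v p * ip b b - ip v b * ip b p) = 0"
    by (simp add: algebra_simps)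
  then show ?thesis using c0 by simp
qed

text \<open>If \<open>p\<close> had a nonzero orthogonal projection to \<open>M\<close>, every root
  of \<open>N\<close> outside \<open>M\<close> would project from \<open>p\<close> into that one
  line. Reflecting \<open>q\<close> in the roots of \<open>M\<close> then forces each of these roots
  into \<open>span {b}\<close> or its complement, against connectedness.\<close>

lemma skew_point_perp:
  assumes q: "q \<in> roots" "q \<in> N" "q \<notin> M" "q \<notin> perp M" and dim: "dim M \<ge> 2"
  shows "p \<in> perp M"
proof (rule ccontr)
  assume np: "p \<notin> perp M"
  obtain c where c: "q - c *s p \<in> M" "q - c *s p \<in> roots"
    using projection_root[OF q(1,2)] .
  define b where "b = q - c *s p"
  have bM: "b \<in> M" and br: "b \<in> roots" using c by (simp_all add: b_def)
  have bp: "ip v p * ip b b = ip v b * ip b p" if "v \<in> M" for v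
    using projection_root_proportional'[OF q(1-3) c that] by (simp add: b_def)
  have bq: "ip v q * ip b b = ip v b * ip b q" if "v \<in> M" for v
    using projection_root_proportional[OF q(1,2) c that] by (simp add: b_def)
  have "r \<in> span {b} \<or> r \<in> perp (span {b})" if r: "r \<in> roots" "r \<in> M" for r
  proof (cases "ip r q = 0")
    case True
    obtain v where "v \<in> M" "ip q v \<noteq> 0" using q(4) by (auto simp: perp_def)
    \<comment> \<open>Otherwise \<open>bq\<close> would make \<open>q\<close> orthogonal to
      \<open>v\<close>.\<close>
    then have "ip b q \<noteq> 0"
      using bq[of v] ip_root_self[OF br] ip_eq_0_commute[of q v] by auto
    then have "ip r b = 0" using bq[OF r(2)] True by simp
    then show ?thesis unfolding perp_span by (simp add: perp_def)
  next
    case False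
    obtain g k where g: "g \<in> W" "k \<noteq> 0" "\<forall>v. g v = v - (k * ip v r) *s r"
      using root_reflection[OF r(1)] .
    define x where "x = k * ip q r"
    have x0: "x \<noteq> 0" using g(2) False ip_eq_0_commute[of q r] by (simp add: x_def)
    have gq: "g q = q - x *s r" by (simp add: g(3) x_def)
    \<comment> \<open>The projection of \<open>g q\<close> from \<open>p\<close>: the summand along
      \<open>r\<close> lies in \<open>M\<close> and is left alone.\<close>
    define b' where "b' = b - x *s r"
    have gqr: "g q \<in> roots" by (rule roots_image[OF g(1) q(1)])
    have gqN: "g q \<in> N"
      unfolding gq using q(2) r(2) M_subset_N N_subspace by (intro subspace_diff subspace_scale) auto
    have b'M: "b' \<in> M" unfolding b'_def using bM r(2) M_subspace by (intro subspace_diff subspace_scale)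
    have gqM: "g q \<notin> M"
    proof
      assume "g q \<in> M"
      then have "g q + x *s r \<in> M" using r(2) M_subspace by (intro subspace_add subspace_scale)
      then show False using q(3) by (simp add: gq)
    qed
    obtain d where d: "g q - d *s p \<in> M" "g q - d *s p \<in> roots"
      using projection_root[OF gqr gqN] .
    have e: "g q - d *s p = b' + (c - d) *s p" by (simp add: gq b'_def b_def algebra_simps)
    then have "(c - d) *s p = (g q - d *s p) - b'" by simp
    then have "(c - d) *s p \<in> M" using d(1) b'M M_subspace by (metis subspace_diff)
    then have "c - d = 0" using subspace_scale_cancel[OF M_subspace] p_notin_M by blast
    then have eb': "g q - d *s p = b'" using e by simp
    have b'r: "b' \<in> roots" using d(2) eb' by simp
    have b'p: "ip v p * ip b' b' = ip v b' * ip b' p" if "v \<in> M" for v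
      using projection_root_proportional'[OF gqr gqN gqM d that] by (simp add: eb')
    define y where "y = ip r b / ip b b"
    \<comment> \<open>The part of \<open>r\<close> orthogonal to \<open>b\<close>. It is orthogonal
      to \<open>p\<close>, hence to \<open>b'\<close>, hence to \<open>r\<close> and to
      itself.\<close>
    define v where "v = r - y *s b"
    have vM: "v \<in> M" unfolding v_def using bM r(2) M_subspace by (intro subspace_diff subspace_scale)
    have vb: "ip v b = 0" using ip_root_self[OF br] by (simp add: v_def y_def ip_simps)
    then have "ip v p = 0" using bp[OF vM] ip_root_self[OF br] by simp
    then have "ip v b' * ip b' p = 0" using b'p[OF vM] by simp
    moreover have "ip b' p \<noteq> 0"
    proof
      assume "ip b' p = 0"
      then have "ip w p = 0" if "w \<in> M" for w using b'p[OF that] ip_root_self[OF b'r] by simp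
      then show False using np ip_eq_0_commute by (auto simp: perp_def)
    qed
    ultimately have "ip v b' = 0" by simp
    then have "ip v r = 0" using vb x0 by (simp add: b'_def ip_simps)
    then have "ip v (r - y *s b) = 0" using vb by (simp add: ip_simps)
    then have "ip v v = 0" by (simp only: v_def)
    then have "v = 0" by (rule ip_self_eq_0)
    then have "r = y *s b" by (simp add: v_def)
    then show ?thesis by (auto simp: span_singleton)
  qed
  then have "M \<subseteq> span {b} \<or> M \<subseteq> perp (span {b})"
    by (intro modular_flat_no_split[OF M]) auto
  moreover have "\<not> M \<subseteq> perp (span {b})"
    unfolding perp_span using bM ip_root_self[OF br] by (auto simp: perp_def)
  moreover have "\<not> M \<subseteq> span {b}"
  proof
    assume "M \<subseteq> span {b}"
    then have "dim M \<le> dim (span {b})" by (rule dim_subset)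
    then show False using dim root_nonzero[OF br] by simp
  qed
  ultimately show False by blast
qed

end

section \<open>Extension of modular flats\<close>

context irreducible_reflection_group
begin

text \<open>The conjugates of \<open>M\<close> under the stabiliser of \<open>N\<close> shrink a
  non-flat section \<open>F \<inter> N\<close> to a line, and orthogonality to two distinct
  conjugates makes that line isotropic.\<close>

lemma modular_flat_span_insert:
  assumes M: "modular_flat M" and dim: "dim M \<ge> 2"
    and q: "q \<in> roots" "q \<notin> M" "q \<notin> perp M"
  shows "modular_flat (span (insert q M))"
proof -
  define N where "N = span (insert q M)"
  have sM: "subspace M" by (rule modular_flat_subspace[OF M])
  have sN: "subspace N" by (simp add: N_def)
  have MN: "M \<subseteq> N" and qN: "q \<in> N"
    unfolding N_def by (auto intro: span_base)
  have exch: "\<exists>c. x - c *s y \<in> M" if "x \<in> N" "y \<in> N" "y \<notin> M" for x y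
    using span_insert_exchange[OF sM, of x q y] that unfolding N_def by blast
  have "flat (F \<inter> N)" if F: "flat F" for F
  proof (rule ccontr)
    assume not_flat: "\<not> flat (F \<inter> N)"
    have sF: "subspace F" by (rule flat_subspace[OF F])
    define \<Gamma> where "\<Gamma> = {g \<in> W. \<forall>v. g v \<in> N \<longleftrightarrow> v \<in> N}"
    have \<Gamma>_comp: "g \<circ> h \<in> \<Gamma>" if "g \<in> \<Gamma>" "h \<in> \<Gamma>" for g h
      using that W_comp by (auto simp: \<Gamma>_def)
    have \<Gamma>_reflection: "g \<in> \<Gamma>" if "g \<in> W" "\<forall>v. g v = v - (k * ip v r) *s r" "r \<in> N" for g k r
    proof -
      have "v \<in> N" if "g v \<in> N" for v
      proof -
        have "g v + (k * ip v r) *s r \<in> N"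
          using that \<open>r \<in> N\<close> sN by (intro subspace_add subspace_scale)
        then show ?thesis using \<open>\<forall>v. g v = v - (k * ip v r) *s r\<close> by simp
      qed
      moreover have "g v \<in> N" if "v \<in> N" for v
        using that \<open>r \<in> N\<close> sN unfolding \<open>\<forall>v. g v = v - (k * ip v r) *s r\<close>[rule_format]
        by (intro subspace_diff subspace_scale)
      ultimately show ?thesis using that(1) unfolding \<Gamma>_def by blast
    qed
    obtain s k where s: "s \<in> W" "k \<noteq> 0" "\<forall>v. s v = v - (k * ip v q) *s q"
      using root_reflection[OF q(1)] .
    obtain s' where s': "s' \<in> W" "\<forall>v. s' (s v) = v" "\<forall>v. s (s' v) = v"
      using W_obtain_inverse[OF s(1)] .
    have "s' \<circ> s = id" using s'(2) by (auto simp: fun_eq_iff)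
    then have "id \<in> \<Gamma>" using W_comp[OF s'(1) s(1)] by (simp add: \<Gamma>_def)
    have s\<Gamma>: "s \<in> \<Gamma>" using \<Gamma>_reflection[OF s(1,3) qN] .
    have vim: "modular_flat (g -` M)" "g -` M \<subseteq> N" if "g \<in> \<Gamma>" for g
      using that modular_flat_vimage[OF _ M] MN by (auto simp: \<Gamma>_def)
    have vim_exch: "\<exists>c. x - c *s y \<in> g -` M" if g: "g \<in> \<Gamma>" and "x \<in> N" "y \<in> N" "y \<notin> g -` M" for g x y
    proof -
      have "g x \<in> N" "g y \<in> N" "g y \<notin> M" "g \<in> W" using that by (auto simp: \<Gamma>_def)
      then obtain c where "g x - c *s g y \<in> M" using exch by blast
      then show ?thesis using W_diff[OF \<open>g \<in> W\<close>] W_scale[OF \<open>g \<in> W\<close>] by auto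
    qed
    have fM: "flat (F \<inter> M)" using M F by (simp add: modular_flat_def)
    \<comment> \<open>A root of \<open>F\<close> in a conjugate of \<open>M\<close> but outside
      \<open>M\<close> would span \<open>F \<inter> N\<close> together with the flat
      \<open>F \<inter> M\<close>.\<close>
    have sub_M: "F \<inter> g -` M \<subseteq> M" if g: "g \<in> \<Gamma>" for g
    proof (rule ccontr)
      assume *: "\<not> F \<inter> g -` M \<subseteq> M"
      have "flat (F \<inter> g -` M)" using vim(1)[OF g] F by (simp add: modular_flat_def)
      then obtain r where r: "r \<in> F" "r \<in> g -` M" "r \<in> roots" "r \<notin> M"
        using flat_subset_roots[OF _ sM] * by blast
      have rN: "r \<in> N" using r(2) vim(2)[OF g] by blast
      have "F \<inter> N \<subseteq> span (F \<inter> N \<inter> roots)"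
      proof
        fix x assume x: "x \<in> F \<inter> N"
        then obtain c where c: "x - c *s r \<in> M" using exch rN r(4) by blast
        have "x - c *s r \<in> F" using x r(1) sF by (intro subspace_diff subspace_scale) auto
        then have "x - c *s r \<in> span (F \<inter> M \<inter> roots)"
          using c flat_eq_span_roots[OF fM] by simp
        moreover have "span (F \<inter> M \<inter> roots) \<subseteq> span (F \<inter> N \<inter> roots)"
          using MN by (intro span_mono) auto
        ultimately have "x - c *s r \<in> span (F \<inter> N \<inter> roots)" by blast
        moreover have "r \<in> span (F \<inter> N \<inter> roots)"
          using r rN by (intro span_base) auto
        ultimately have "(x - c *s r) + c *s r \<in> span (F \<inter> N \<inter> roots)"
          by (intro span_add span_scale)
        then show "x \<in> span (F \<inter> N \<inter> roots)" by simp
      qed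
      then have "flat (F \<inter> N)" using sF sN by (intro flatI subspace_inter)
      then show False using not_flat by blast
    qed
    have "\<not> F \<inter> N \<subseteq> M"
    proof
      assume "F \<inter> N \<subseteq> M"
      then have "F \<inter> N = F \<inter> M" using MN by blast
      then show False using fM not_flat by simp
    qed
    then obtain p where p: "p \<in> F" "p \<in> N" "p \<notin> M" by blast
    \<comment> \<open>The intersection of all conjugates of \<open>M\<close> under
      \<open>\<Gamma>\<close>.\<close>
    define U where "U = {u. \<forall>g\<in>\<Gamma>. g u \<in> M}"
    \<comment> \<open>If \<open>d\<close> missed a conjugate, some \<open>p - c *s d\<close> would
      lie in it, hence in \<open>M\<close> by \<open>sub_M\<close>, and so would
      \<open>p\<close>.\<close>
    have in_U: "d \<in> U" if d: "d \<in> F" "d \<in> M" for d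
    proof (rule ccontr)
      assume "d \<notin> U"
      then obtain g where g: "g \<in> \<Gamma>" "d \<notin> g -` M" by (auto simp: U_def)
      obtain c where c: "p - c *s d \<in> g -` M"
        using vim_exch[OF g(1) p(2) _ g(2)] d(2) MN by blast
      have "p - c *s d \<in> F" using p(1) d(1) sF by (intro subspace_diff subspace_scale)
      then have "p - c *s d \<in> M" using c sub_M[OF g(1)] by blast
      then have "(p - c *s d) + c *s d \<in> M" using d(2) sM by (intro subspace_add subspace_scale)
      then show False using p(3) by simp
    qed
    have UM: "U \<subseteq> M" using \<open>id \<in> \<Gamma>\<close> by (auto simp: U_def)
    have sU: "subspace U"
    proof (rule subspaceI)
      show "0 \<in> U"
      proof -
        have "g 0 \<in> M" if "g \<in> \<Gamma>" for g
          using that W_diff[of g 0 0] subspace_0[OF sM] by (simp add: \<Gamma>_def)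
        then show ?thesis by (simp add: U_def)
      qed
      show "x + y \<in> U" if "x \<in> U" "y \<in> U" for x y
        using that subspace_add[OF sM] by (auto simp: U_def \<Gamma>_def W_add)
      show "c *s x \<in> U" if "x \<in> U" for c x
        using that subspace_scale[OF sM] by (auto simp: U_def \<Gamma>_def W_scale)
    qed
    have U_split: "r \<in> U \<or> r \<in> perp U" if r: "r \<in> roots" "r \<in> N" for r
    proof -
      obtain g k where g: "g \<in> W" "k \<noteq> 0" "\<forall>v. g v = v - (k * ip v r) *s r"
        using root_reflection[OF r(1)] .
      have g\<Gamma>: "g \<in> \<Gamma>" using \<Gamma>_reflection[OF g(1,3) r(2)] .
      have "g u \<in> U" if "u \<in> U" for u
      proof -
        have "(h \<circ> g) u \<in> M" if "h \<in> \<Gamma>" for h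
          using \<open>u \<in> U\<close> \<Gamma>_comp[OF that g\<Gamma>] unfolding U_def by blast
        then show ?thesis by (simp add: U_def)
      qed
      then show ?thesis using root_in_or_perp_invariant[OF sU g(3,2)] by blast
    qed
    \<comment> \<open>\<open>U\<close> is invariant under all reflections with root in
      \<open>N\<close>, so connectedness of \<open>M\<close> applies; \<open>M \<subseteq> U\<close>
      is impossible since \<open>q\<close> is orthogonal to \<open>U\<close> but not to
      \<open>M\<close>.\<close>
    have "U = {0}"
    proof -
      have "M \<subseteq> U \<or> M \<subseteq> perp U"
        using U_split MN by (intro modular_flat_no_split[OF M sU]) blast
      moreover have "q \<in> perp U" using U_split[OF q(1) qN] UM q(2) by blast
      then have "\<not> M \<subseteq> U" using q(3) perp_antimono[of M U] by blast
      ultimately have "U \<subseteq> perp U" using UM by blast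
      then show ?thesis using perp_Int_self[OF sU] by blast
    qed
    have FN: "F \<inter> N = span {p}"
    proof
      show "span {p} \<subseteq> F \<inter> N" using p sF sN by (intro span_minimal subspace_inter) auto
      show "F \<inter> N \<subseteq> span {p}"
      proof
        fix x assume x: "x \<in> F \<inter> N"
        then obtain c where c: "x - c *s p \<in> M" using exch p(2,3) by blast
        have "x - c *s p \<in> F" using x p(1) sF by (intro subspace_diff subspace_scale) auto
        then have "x = c *s p" using in_U c \<open>U = {0}\<close> by fastforce
        then show "x \<in> span {p}" by (auto simp: span_singleton)
      qed
    qed
    have p_root: "p \<notin> roots"
    proof
      assume "p \<in> roots"
      then have "flat (span {p})" unfolding flat_def by (intro exI[of _ "{p}"]) auto
      then show False using FN not_flat by simp
    qed
    have perp: "p \<in> perp (g -` M)"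
      if g: "g \<in> \<Gamma>" and "q \<notin> g -` M" "q \<notin> perp (g -` M)" "dim (g -` M) \<ge> 2" for g
    proof -
      have "p \<notin> g -` M" using sub_M[OF g] p by blast
      then interpret skew_point scale Basis ip W "g -` M" N F p
        using vim[OF g] vim_exch[OF g] F FN p_root sN by unfold_locales auto
      show ?thesis using skew_point_perp[OF q(1) qN] that by blast
    qed
    have "p \<in> perp M" using perp[OF \<open>id \<in> \<Gamma>\<close>] q dim by simp
    define M' where "M' = s -` M"
    have sq: "s q = (1 - k * ip q q) *s q" by (simp add: s(3) algebra_simps)
    have "ip (s q) (s q) \<noteq> 0" using W_ip[OF s(1)] ip_root_self[OF q(1)] by simp
    \<comment> \<open>The eigenvalue of \<open>s\<close> on \<open>q\<close>, nonzero because
      \<open>s\<close> preserves the form.\<close>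
    then have z0: "1 - k * ip q q \<noteq> 0" by (auto simp: sq)
    obtain v where v: "v \<in> M" "ip q v \<noteq> 0" using q(3) by (auto simp: perp_def)
    have s'v: "s' v \<in> M'" using v s'(3) by (simp add: M'_def)
    have "p \<in> perp M'"
      unfolding M'_def
    proof (rule perp[OF s\<Gamma>])
      show "q \<notin> s -` M"
        using subspace_scale_cancel[OF sM _ q(2), of "1 - k * ip q q"] z0 by (auto simp: sq)
      have "ip (s q) (s (s' v)) = ip q (s' v)" by (rule W_ip[OF s(1)])
      then have "ip q (s' v) = (1 - k * ip q q) * ip q v"
        by (simp add: s'(3) sq ip_scale_left)
      then have "ip q (s' v) \<noteq> 0" using z0 v(2) by simp
      then show "q \<notin> perp (s -` M)" using s'v by (auto simp: perp_def M'_def)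
      interpret s: finite_dimensional_vector_space_pair_1 scale Basis scale by unfold_locales
      have "s ` (s -` M) = M" using s'(3) by (metis surjI surj_image_vimage_eq)
      then have "dim M \<le> dim (s -` M)"
        using s.dim_image_le[OF W_linear[OF s(1)], of "s -` M"] by simp
      then show "2 \<le> dim (s -` M)" using dim by simp
    qed
    \<comment> \<open>This shows \<open>M'\<close> differs from \<open>M\<close>: \<open>v\<close>
      is not orthogonal to \<open>q\<close>, so the inverse reflection moves it out of
      \<open>M\<close>.\<close>
    have u_notin: "s' v \<notin> M"
    proof
      assume u: "s' v \<in> M"
      have e: "v = s' v - (k * ip (s' v) q) *s q"
        using s(3)[rule_format, of "s' v"] s'(3) by simp
      then have "(k * ip (s' v) q) *s q = s' v - v" by (simp add: algebra_simps)
      then have "(k * ip (s' v) q) *s q \<in> M" using u v(1) sM by (simp add: subspace_diff)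
      then have "k * ip (s' v) q = 0" using subspace_scale_cancel[OF sM] q(2) by blast
      then have "ip (s' v) q = 0" "v = s' v" using e s(2) by auto
      then show False using v(2) ip_eq_0_commute[of q v] by simp
    qed
    have "s' v \<in> N" using s'v vim(2)[OF s\<Gamma>] by (auto simp: M'_def)
    then obtain c where "p - c *s s' v \<in> M" using exch[OF p(2) _ u_notin] by blast
    \<comment> \<open>\<open>p\<close> is a sum of a vector of \<open>M\<close> and a multiple of
      \<open>s' v\<close> in \<open>M'\<close>, and is orthogonal to both.\<close>
    then have "ip p (p - c *s s' v) = 0" using \<open>p \<in> perp M\<close> by (auto simp: perp_def)
    moreover have "ip p (s' v) = 0" using \<open>p \<in> perp M'\<close> s'v by (auto simp: perp_def)
    ultimately have "ip p p = 0" by (simp add: ip_simps)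
    then have "p = 0" by (rule ip_self_eq_0)
    then show False using p(3) subspace_0[OF sM] by simp
  qed
  moreover have "flat N"
    unfolding N_def using modular_flat_flat[OF M] q(1) by (rule flat_span_insert)
  ultimately show ?thesis by (simp add: modular_flat_def N_def)
qed

end

section \<open>Chains of modular flats\<close>

context hermitian_space
begin

lemma subspace_dim_psubset:
  assumes "subspace U" "subspace V" "U \<subset> V"
  shows "dim U < dim V"
  using assms by (intro dim_psubset) (simp add: span_eq_iff[THEN iffD2])

lemma perp_psubset_iff:
  assumes "subspace U" "subspace V"
  shows "perp U \<subset> perp V \<longleftrightarrow> V \<subset> U"
  using assms perp_antimono[of V U] perp_antimono[of "perp U" "perp V"] perp_eq_iff[OF assms]
  by (auto simp: perp_perp)

end

section \<open>The arrangement lattice as the dual of the lattice of flats\<close>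

context unitary_group
begin

definition root_arrangement :: "'v set set" where
  "root_arrangement = (\<lambda>a. perp {a}) ` roots"

text \<open>Intersecting the hyperplanes of a set of roots gives the complement of its span; the
  empty set gives the whole space.\<close>

lemma intersection_lattice_root_arrangement:
  "intersection_lattice root_arrangement = perp ` {F. flat F}"
proof (intro equalityI subsetI)
  fix X assume "X \<in> intersection_lattice root_arrangement"
  then obtain \<B> where \<B>: "\<B> \<subseteq> root_arrangement" "X = \<Inter>\<B>"
    by (auto simp: intersection_lattice_def)
  define B where "B = {a \<in> roots. perp {a} \<in> \<B>}"
  have "\<B> = (\<lambda>a. perp {a}) ` B"
    using \<B>(1) by (auto simp: root_arrangement_def B_def)
  then have "X = perp B" by (auto simp: \<B>(2) perp_def)
  then have "X = perp (span B)" by (simp add: perp_span)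
  moreover have "flat (span B)" unfolding flat_def by (intro exI[of _ B]) (auto simp: B_def)
  ultimately show "X \<in> perp ` {F. flat F}" by blast
next
  fix X assume "X \<in> perp ` {F. flat F}"
  then obtain B where B: "B \<subseteq> roots" "X = perp (span B)" by (auto simp: flat_def)
  then have "X = \<Inter>((\<lambda>a. perp {a}) ` B)" by (auto simp: perp_span) (auto simp: perp_def)
  moreover have "(\<lambda>a. perp {a}) ` B \<subseteq> root_arrangement"
    using B(1) by (auto simp: root_arrangement_def)
  ultimately show "X \<in> intersection_lattice root_arrangement"
    unfolding intersection_lattice_def by blast
qed

lemma modular_element_perp_iff:
  assumes M: "flat M"
  shows "modular_element root_arrangement (perp M) \<longleftrightarrow> modular_flat M"
proof -
  have sM: "subspace M" by (rule flat_subspace[OF M])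
  have "{x + y |x y. x \<in> perp M \<and> y \<in> perp F} \<in> perp ` {F. flat F} \<longleftrightarrow> flat (F \<inter> M)" if F: "flat F" for F
  proof -
    let ?S = "{x + y |x y. x \<in> perp M \<and> y \<in> perp F}"
    have S: "perp ?S = F \<inter> M"
      using perp_sum[OF subspace_perp subspace_perp, of M F] sM flat_subspace[OF F]
      by (simp add: perp_perp Int_commute)
    have sS: "subspace ?S" by (intro subspace_sums subspace_perp)
    show ?thesis
    proof
      assume "?S \<in> perp ` {F. flat F}"
      then obtain G where G: "?S = perp G" "flat G" by blast
      then have "F \<inter> M = G" using S perp_perp[OF flat_subspace[OF G(2)]] by simp
      then show "flat (F \<inter> M)" using G(2) by simp
    next
      assume "flat (F \<inter> M)"
      moreover have "?S = perp (F \<inter> M)" using perp_perp[OF sS] S by simp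
      ultimately show "?S \<in> perp ` {F. flat F}" by blast
    qed
  qed
  then show ?thesis
    using M unfolding modular_element_def intersection_lattice_root_arrangement modular_flat_def
    by auto
qed

lemma modular_flat_0: "modular_flat {0}"
proof -
  have "flat {0}" unfolding flat_def by (intro exI[of _ "{}"]) simp
  moreover have "F \<inter> {0} = {0}" if "flat F" for F
    using subspace_0[OF flat_subspace[OF that]] by blast
  ultimately show ?thesis by (simp add: modular_flat_def)
qed

lemma modular_flat_line:
  assumes a: "a \<in> roots"
  shows "modular_flat (span {a})"
proof -
  have l: "flat (span {a})" unfolding flat_def using a by (intro exI[of _ "{a}"]) auto
  moreover have "flat (F \<inter> span {a})" if F: "flat F" for F
  proof (cases "a \<in> F")
    case True
    then have "F \<inter> span {a} = span {a}"
      using span_minimal[of "{a}" F] flat_subspace[OF F] by auto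
    then show ?thesis using l by simp
  next
    case False
    have "F \<inter> span {a} = {0}"
      using subspace_scale_cancel[OF flat_subspace[OF F] _ False] subspace_0[OF flat_subspace[OF F]]
      by (auto simp: span_singleton)
    then show ?thesis using modular_flat_0 by (simp add: modular_flat_def)
  qed
  ultimately show ?thesis by (simp add: modular_flat_def)
qed

text \<open>A strictly descending chain with as many steps as the dimension loses exactly one
  dimension per step, so \<open>X 2\<close> has codimension 2.\<close>

lemma supersolvable_imp_modular_codim_2:
  assumes ss: "supersolvable root_arrangement" and n: "2 \<le> dim (UNIV :: 'v set)"
  shows "\<exists>X\<in>intersection_lattice root_arrangement. modular_element root_arrangement X \<and> codim X = 2"
proof -
  let ?n = "dim (UNIV :: 'v set)"
  from ss[unfolded supersolvable_def] obtain X where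
    "X 0 = UNIV \<and> X ?n = {0} \<and> (\<forall>i\<le>?n. modular_element root_arrangement (X i)) \<and>
      (\<forall>i<?n. X (Suc i) \<subset> X i \<and>
        \<not> (\<exists>Z\<in>intersection_lattice root_arrangement. X (Suc i) \<subset> Z \<and> Z \<subset> X i))" ..
  then have X0: "X 0 = UNIV"
    and mod: "\<And>i. i \<le> ?n \<Longrightarrow> modular_element root_arrangement (X i)"
    and strict: "\<And>i. i < ?n \<Longrightarrow> X (Suc i) \<subset> X i"
    by simp_all
  have sub: "subspace (X i)" if "i \<le> ?n" for i
    using mod[OF that] subspace_perp
    by (auto simp: modular_element_def intersection_lattice_root_arrangement)
  have less: "dim (X (Suc i)) < dim (X i)" if "i < ?n" for i
    using strict[OF that] sub that by (intro subspace_dim_psubset) auto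
  have upper: "i \<le> ?n \<Longrightarrow> dim (X i) + i \<le> ?n" for i
  proof (induction i)
    case 0
    then show ?case by (simp add: X0)
  next
    case (Suc i)
    then show ?case using less[of i] by simp
  qed
  \<comment> \<open>Counts upwards from the end of the chain.\<close>
  have lower: "j \<le> ?n \<Longrightarrow> dim (X (?n - j)) \<ge> j" for j
  proof (induction j)
    case 0
    then show ?case by simp
  next
    case (Suc j)
    then have "Suc (?n - Suc j) = ?n - j" by simp
    then show ?case using Suc less[of "?n - Suc j"] by fastforce
  qed
  have "dim (X 2) = ?n - 2" using upper[OF n] lower[of "?n - 2"] n by simp
  then have "codim (X 2) = 2" using n by (simp add: codim_def)
  then show ?thesis using mod[OF n] by (auto simp: modular_element_def)
qed

end

context irreducible_reflection_group
begin

text \<open>Starts with \<open>{0}\<close>, the line of a root of \<open>M\<close>, and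
  \<open>M\<close>; every later member adjoins a root to the one before.\<close>

lemma modular_flat_chain:
  assumes M: "modular_flat M" "dim M = 2" and k: "2 \<le> k" "k \<le> dim (UNIV :: 'v set)"
  shows "\<exists>C :: nat \<Rightarrow> 'v set. (\<forall>i\<le>k. modular_flat (C i) \<and> dim (C i) = i) \<and> (\<forall>i<k. C i \<subseteq> C (Suc i))"
  using k
proof (induction k rule: dec_induct)
  case base
  have "\<not> M \<inter> roots \<subseteq> {0}"
  proof
    assume "M \<inter> roots \<subseteq> {0}"
    then have "M \<subseteq> {0}" by (intro flat_subset_roots[OF modular_flat_flat[OF M(1)]]) auto
    then show False using M(2) dim_eq_0[of M] by simp
  qed
  then obtain a where a: "a \<in> M" "a \<in> roots" by blast
  define C where "C = (\<lambda>i::nat. if i = 0 then {0} else if i = 1 then span {a} else M)"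
  have "modular_flat (C i) \<and> dim (C i) = i" if "i \<le> 2" for i
  proof -
    have "i = 0 \<or> i = 1 \<or> i = 2" using that by auto
    then show ?thesis
      using M modular_flat_0 modular_flat_line[OF a(2)] root_nonzero[OF a(2)]
      by (auto simp: C_def)
  qed
  moreover have "C i \<subseteq> C (Suc i)" if "i < 2" for i
  proof -
    have "i = 0 \<or> i = 1" using that by auto
    moreover have "span {a} \<subseteq> M"
      using a(1) modular_flat_subspace[OF M(1)] by (intro span_minimal) auto
    ultimately show ?thesis by (auto simp: C_def span_zero)
  qed
  ultimately show ?case by blast
next
  case (step k)
  then have "\<exists>C :: nat \<Rightarrow> 'v set. (\<forall>i\<le>k. modular_flat (C i) \<and> dim (C i) = i) \<and> (\<forall>i<k. C i \<subseteq> C (Suc i))"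
    by simp
  then obtain C :: "nat \<Rightarrow> 'v set" where
    "(\<forall>i\<le>k. modular_flat (C i) \<and> dim (C i) = i) \<and> (\<forall>i<k. C i \<subseteq> C (Suc i))" ..
  then have C: "\<And>i. i \<le> k \<Longrightarrow> modular_flat (C i) \<and> dim (C i) = i" "\<And>i. i < k \<Longrightarrow> C i \<subseteq> C (Suc i)"
    by simp_all
  have Ck: "modular_flat (C k)" "dim (C k) = k" using C(1)[of k] by auto
  have "C k \<noteq> {0}" "C k \<noteq> UNIV" using Ck(2) step by (auto simp del: dim_UNIV)
  \<comment> \<open>Irreducibility: a nonzero proper subspace cannot split the roots.\<close>
  then obtain q where q: "q \<in> roots" "q \<notin> C k" "q \<notin> perp (C k)"
    using irreducible[OF modular_flat_subspace[OF Ck(1)]] by blast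
  define D where "D = C(Suc k := span (insert q (C k)))"
  have "modular_flat (span (insert q (C k)))"
    using modular_flat_span_insert[OF Ck(1) _ q] Ck(2) step by simp
  moreover have "dim (span (insert q (C k))) = Suc k"
    using q(2) Ck(2) modular_flat_subspace[OF Ck(1)]
    by (simp add: dim_insert span_eq_iff[THEN iffD2])
  ultimately have "modular_flat (D i) \<and> dim (D i) = i" if "i \<le> Suc k" for i
    using C(1)[of i] that by (auto simp: D_def le_Suc_eq)
  moreover have "D i \<subseteq> D (Suc i)" if "i < Suc k" for i
    using C(2)[of i] that by (auto simp: D_def less_Suc_eq intro: span_base)
  ultimately show ?case by blast
qed

text \<open>Complements of the chain of modular flats; consecutive dimensions differ by one, which
  leaves no room for a lattice element in between.\<close>

lemma modular_codim_2_imp_supersolvable: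
  assumes X: "modular_element root_arrangement X" "codim X = 2"
  shows "supersolvable root_arrangement"
proof -
  let ?n = "dim (UNIV :: 'v set)"
  obtain M where M: "flat M" "X = perp M"
    using X(1) by (auto simp: modular_element_def intersection_lattice_root_arrangement)
  have mM: "modular_flat M" using X(1) modular_element_perp_iff[OF M(1)] M(2) by simp
  have dM: "dim M = 2" and n: "2 \<le> ?n"
    using X(2) dim_perp[OF flat_subspace[OF M(1)]] by (simp_all add: codim_def M(2) del: dim_UNIV)
  from modular_flat_chain[OF mM dM n] obtain C where
    "(\<forall>i\<le>?n. modular_flat (C i) \<and> dim (C i) = i) \<and> (\<forall>i<?n. C i \<subseteq> C (Suc i))" by auto
  then have C: "\<And>i. i \<le> ?n \<Longrightarrow> modular_flat (C i)" "\<And>i. i \<le> ?n \<Longrightarrow> dim (C i) = i"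
    and CC: "\<And>i. i < ?n \<Longrightarrow> C i \<subseteq> C (Suc i)"
    by simp_all
  have sC: "subspace (C i)" if "i \<le> ?n" for i using modular_flat_subspace C(1)[OF that] .
  have "C 0 = {0}" using C(2)[of 0] subspace_0[OF sC[of 0]] by auto
  moreover have "C ?n = UNIV"
    using C(2)[of ?n] sC[of ?n] by (intro subspace_dim_equal) (auto simp del: dim_UNIV)
  moreover have "modular_element root_arrangement (perp (C i))" if "i \<le> ?n" for i
    using C(1)[OF that] modular_element_perp_iff[OF modular_flat_flat] by blast
  moreover have "perp (C (Suc i)) \<subset> perp (C i) \<and>
      \<not> (\<exists>Z\<in>intersection_lattice root_arrangement. perp (C (Suc i)) \<subset> Z \<and> Z \<subset> perp (C i))"
    if i: "i < ?n" for i
  proof (intro conjI notI)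
    have s: "subspace (C i)" "subspace (C (Suc i))" using sC i by auto
    have "C i \<noteq> C (Suc i)" using C(2)[of i] C(2)[of "Suc i"] i by auto
    then show "perp (C (Suc i)) \<subset> perp (C i)" using CC[OF i] perp_psubset_iff[OF s(2,1)] by blast
    assume "\<exists>Z\<in>intersection_lattice root_arrangement. perp (C (Suc i)) \<subset> Z \<and> Z \<subset> perp (C i)"
    then obtain F where F: "flat F" "perp (C (Suc i)) \<subset> perp F" "perp F \<subset> perp (C i)"
      by (auto simp: intersection_lattice_root_arrangement)
    then have "C i \<subset> F" "F \<subset> C (Suc i)"
      using perp_psubset_iff s flat_subspace[OF F(1)] by auto
    then have "dim (C i) < dim F" "dim F < dim (C (Suc i))"
      using subspace_dim_psubset s flat_subspace[OF F(1)] by auto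
    then show False using C(2)[of i] C(2)[of "Suc i"] i by simp
  qed
  ultimately show ?thesis
    unfolding supersolvable_def by (intro exI[of _ "\<lambda>i. perp (C i)"]) simp
qed

end

section \<open>Reflections of the group and their roots\<close>

context unitary_group
begin

lemma W_reflection_root:
  assumes g: "g \<in> W" and hyp: "hyperplane {v. g v = v}"
  obtains a k where "a \<in> roots" "{v. g v = v} = perp {a}" "\<forall>v. g v = v - (k * ip v a) *s a"
proof -
  define H where "H = {v. g v = v}"
  have sH: "subspace H" and dH: "dim H + 1 = dim (UNIV :: 'v set)"
    using hyp by (auto simp: hyperplane_def H_def)
  have "H \<noteq> UNIV" using dH by auto
  then obtain w where w: "w \<notin> H" by blast
  obtain u where u: "u \<in> H" "w - u \<in> perp H" using orthogonal_projection[OF sH] .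
  define a where "a = w - u"
  have a0: "a \<noteq> 0" using w u(1) by (auto simp: a_def)
  have "H \<subseteq> perp {a}" using u(2) ip_eq_0_commute by (auto simp: perp_def a_def)
  then have H: "H = perp {a}"
    using sH subspace_perp dH dim_perp_singleton[OF a0] by (intro subspace_dim_equal) auto
  have aa: "ip a a \<noteq> 0" using a0 ip_self_eq_0 by blast
  define z where "z = ip (g a) a / ip a a"
  \<comment> \<open>The part of \<open>g a\<close> orthogonal to \<open>a\<close>. It is fixed by
    \<open>g\<close>, so unitarity makes it orthogonal to \<open>g a\<close> and hence to
    itself.\<close>
  define x where "x = g a - z *s a"
  have xa: "ip x a = 0" using aa by (simp add: x_def z_def ip_simps)
  then have "g x = x" using H by (auto simp: H_def perp_def)
  then have "ip (g a) x = ip a x" using W_ip[OF g, of a x] by simp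
  then have "ip (g a) x = 0" "ip a x = 0" using xa ip_eq_0_commute by auto
  then have "ip (g a - z *s a) x = 0" by (simp add: ip_simps)
  then have "x = 0" by (intro ip_self_eq_0) (simp add: x_def)
  then have ga: "g a = z *s a" by (simp add: x_def)
  have "z \<noteq> 1"
  proof
    assume "z = 1"
    then have "a \<in> H" by (simp add: H_def ga)
    then show False using H aa by (auto simp: perp_def)
  qed
  \<comment> \<open>Solves \<open>a - (k * ip a a) *s a = z *s a\<close>.\<close>
  define k where "k = (1 - z) / ip a a"
  have gv: "g v = v - (k * ip v a) *s a" for v
  proof -
    define c where "c = ip v a / ip a a"
    have "v - c *s a \<in> H" using aa by (simp add: H perp_def c_def ip_simps)
    then have "g v - (c * z) *s a = v - c *s a" by (simp add: H_def W_diff[OF g] W_scale[OF g] ga)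
    then have "g v = v - c *s a + (c * z) *s a" by (simp add: algebra_simps)
    also have "\<dots> = v - (c * (1 - z)) *s a" by (simp add: algebra_simps)
    also have "c * (1 - z) = k * ip v a" by (simp add: c_def k_def)
    finally show ?thesis .
  qed
  have "k \<noteq> 0" using \<open>z \<noteq> 1\<close> aa by (simp add: k_def)
  then have "a \<in> roots" using g gv a0 unfolding roots_def by blast
  then show ?thesis
    using that[of a k] H gv by (simp add: H_def)
qed

lemma root_hyperplane_reflection:
  assumes a: "a \<in> roots"
  obtains g where "g \<in> W" "reflection g" "{v. g v = v} = perp {a}"
proof -
  obtain g k where g: "g \<in> W" "k \<noteq> 0" "\<forall>v. g v = v - (k * ip v a) *s a"
    using root_reflection[OF a] .
  have fixed: "{v. g v = v} = perp {a}"
    using g(2) root_nonzero[OF a] by (auto simp: g(3) perp_def)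
  obtain h where h: "h \<in> W" "\<forall>v. h (g v) = v" "\<forall>v. g (h v) = v"
    using W_obtain_inverse[OF g(1)] .
  have "bij g" using h(2,3) by (metis bijI' )
  then have GL: "g \<in> carrier GL" using W_linear[OF g(1)] by (simp add: GL_def)
  \<comment> \<open>Reading powers of \<open>g\<close> as iterates of an injective map on functions,
    started at \<open>id\<close>, lets finiteness of the orbit yield a return to \<open>id\<close>,
    hence finite order.\<close>
  have pow: "((\<circ>) g ^^ n) id = g ^^ n" for n
    by (induction n) auto
  have "g ^^ Suc n \<in> W" for n
    using g(1) W_comp by (induction n) auto
  then have "g ^^ n \<in> insert id W" for n by (cases n) (auto simp del: funpow.simps(2))
  then have "{y. \<exists>n. y = ((\<circ>) g ^^ n) id} \<subseteq> insert id W" unfolding pow by blast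
  then have fin: "finite {y. \<exists>n. y = ((\<circ>) g ^^ n) id}" using finite_W finite_subset by blast
  have "inj ((\<circ>) g :: ('v \<Rightarrow> 'v) \<Rightarrow> _)"
    using \<open>bij g\<close> by (intro fun.inj_map bij_is_inj)
  then obtain n where "n > 0" "((\<circ>) g ^^ n) id = id"
    using funpow_inj_finite[OF _ fin] by blast
  then have "\<exists>n>0. g ^^ n = id" using pow by auto
  moreover have "hyperplane {v. g v = v}"
    unfolding fixed hyperplane_def using subspace_perp dim_perp_singleton[OF root_nonzero[OF a]] by blast
  ultimately show ?thesis using that g(1) GL fixed by (simp add: reflection_def)
qed

lemma reflection_arrangement_eq: "reflection_arrangement W = root_arrangement"
proof (intro equalityI subsetI)
  fix H assume "H \<in> reflection_arrangement W"
  then obtain g where g: "g \<in> W" "reflection g" "H = {v. g v = v}"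
    by (auto simp: reflection_arrangement_def)
  then have "hyperplane {v. g v = v}" by (simp add: reflection_def)
  then obtain a where "a \<in> roots" "{v. g v = v} = perp {a}"
    using W_reflection_root[OF g(1)] by metis
  then show "H \<in> root_arrangement" using g(3) by (auto simp: root_arrangement_def)
next
  fix H assume "H \<in> root_arrangement"
  then obtain a where a: "a \<in> roots" "H = perp {a}" by (auto simp: root_arrangement_def)
  obtain g where "g \<in> W" "reflection g" "{v. g v = v} = perp {a}"
    using root_hyperplane_reflection[OF a(1)] .
  then show "H \<in> reflection_arrangement W"
    unfolding reflection_arrangement_def a(2) by (intro CollectI exI[of _ g]) simp
qed

text \<open>A subspace that splits the roots is preserved by every reflection, hence by the group
  they generate.\<close>

lemma irreducible_reflection_groupI:
  assumes gen: "W \<subseteq> generate GL {g \<in> W. reflection g}" and irr: "acts_irreducibly W"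
  shows "irreducible_reflection_group scale Basis ip W"
proof
  fix U assume U: "subspace U" and split: "\<And>a. a \<in> roots \<Longrightarrow> a \<in> U \<or> a \<in> perp U"
  have refl: "g u \<in> U" if g: "g \<in> W" "reflection g" and u: "u \<in> U" for g u
  proof -
    have "hyperplane {v. g v = v}" using g(2) by (simp add: reflection_def)
    then obtain a k where a: "a \<in> roots" "{v. g v = v} = perp {a}" "\<forall>v. g v = v - (k * ip v a) *s a"
      using W_reflection_root[OF g(1)] by metis
    show ?thesis
    proof (cases "a \<in> U")
      case True
      then show ?thesis using u U by (simp add: a(3) subspace_diff subspace_scale)
    next
      case False
      then have "ip u a = 0" using split[OF a(1)] u ip_eq_0_commute[of u a] by (auto simp: perp_def)
      then show ?thesis using u by (simp add: a(3))
    qed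
  qed
  interpret GL: group GL by (rule group_GL)
  have GLmem: "g \<in> carrier GL" if g: "g \<in> W" for g
  proof -
    obtain h where "h \<in> W" "\<forall>v. h (g v) = v" "\<forall>v. g (h v) = v"
      using W_obtain_inverse[OF g] .
    then have "bij g" by (metis bijI')
    then show ?thesis using W_linear[OF g] by (simp add: GL_def)
  qed
  have "g ` U \<subseteq> U" if "g \<in> generate GL {g \<in> W. reflection g}" for g
    using that
  proof induction
    case one
    then show ?case by (simp add: GL_def)
  next
    case (incl g)
    then show ?case using refl by auto
  next
    case (inv g)
    have "inv\<^bsub>GL\<^esub> g \<otimes>\<^bsub>GL\<^esub> g = \<one>\<^bsub>GL\<^esub>" using GLmem[of g] inv by (intro GL.l_inv) auto
    then have inv_g: "(inv\<^bsub>GL\<^esub> g) (g u) = u" for u by (simp add: GL_def fun_eq_iff)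
    obtain n where n: "n > 0" "g ^^ n = id" using inv by (auto simp: reflection_def)
    \<comment> \<open>The inverse acts as \<open>g ^^ (n - 1)\<close>, since \<open>g\<close> has
      finite order.\<close>
    have "(inv\<^bsub>GL\<^esub> g) u \<in> U" if u: "u \<in> U" for u
    proof -
      have "(g ^^ m) u \<in> U" for m using u refl inv by (induction m) auto
      moreover have "g ((g ^^ (n - 1)) u) = u"
        using n by (cases n) (auto simp: fun_eq_iff)
      ultimately show ?thesis using inv_g[of "(g ^^ (n - 1)) u"] by simp
    qed
    then show ?case by blast
  next
    case (eng g h)
    then show ?case by (auto simp: GL_def)
  qed
  then show "U = {0} \<or> U = UNIV"
    using irr gen U unfolding acts_irreducibly_def by blast
qed

end

section \<open>The invariant form\<close>

lemma (in finite_dimensional_vector_space) representation_eq_0_iff: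
  "(\<forall>b\<in>Basis. representation Basis v b = 0) \<longleftrightarrow> v = 0"
proof
  assume "\<forall>b\<in>Basis. representation Basis v b = 0"
  moreover have "v = (\<Sum>b\<in>Basis. representation Basis v b *s b)"
    using sum_representation_eq[OF independent_Basis, of v Basis] finite_Basis span_Basis by auto
  ultimately show "v = 0" by simp
qed (simp add: representation_zero)

text \<open>Averaging: the standard form in coordinates is summed over \<open>W\<close>.\<close>

lemma (in complex_space) invariant_hermitian_form:
  assumes fd: "finite_dimensional_vector_space scale Basis"
    and W: "subgroup W GL" "finite W"
  shows "\<exists>ip. unitary_group scale Basis ip W"
proof -
  interpret fd: finite_dimensional_vector_space scale Basis by (rule fd)
  interpret GL: group GL by (rule group_GL)
  interpret W: subgroup W GL by (rule W(1))
  define ip0 where "ip0 u v = (\<Sum>b\<in>Basis. representation Basis u b * cnj (representation Basis v b))" for u v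
  define ip where "ip u v = (\<Sum>g\<in>W. ip0 (g u) (g v))" for u v
  have rep_add: "representation Basis (u + v) b = representation Basis u b + representation Basis v b" for u v b
    using representation_add[OF fd.independent_Basis] fd.span_Basis by simp
  have rep_scale: "representation Basis (scale c v) b = c * representation Basis v b" for c v b
    using representation_scale[OF fd.independent_Basis] fd.span_Basis by simp
  have W_GL: "g \<in> carrier GL" if "g \<in> W" for g using that W.subset by blast
  have lin: "Vector_Spaces.linear scale scale g" if "g \<in> W" for g
    using W_GL[OF that] by (simp add: GL_def)
  have g_add: "g (u + v) = g u + g v" and g_scale: "g (scale c v) = scale c (g v)" if "g \<in> W" for g u v c
    using lin[OF that] Vector_Spaces.linear_iff by blast+
  have comp: "g \<circ> h \<in> W" if "g \<in> W" "h \<in> W" for g h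
    using W.m_closed[OF that] by (simp add: GL_def)
  have inverse: "\<exists>h\<in>W. h \<circ> g = id \<and> g \<circ> h = id" if "g \<in> W" for g
    using W.m_inv_closed[OF that] GL.l_inv[OF W_GL[OF that]] GL.r_inv[OF W_GL[OF that]]
    by (intro bexI[of _ "inv\<^bsub>GL\<^esub> g"]) (simp_all add: GL_def)
  have "unitary_group scale Basis ip W"
  proof
    show "ip (u + v) w = ip u w + ip v w" for u v w
      unfolding ip_def ip0_def by (simp add: g_add rep_add distrib_right sum.distrib)
    show "ip (scale c v) w = c * ip v w" for c v w
      unfolding ip_def ip0_def by (simp add: g_scale rep_scale sum_distrib_left mult.assoc)
    show "ip v w = cnj (ip w v)" for v w
      unfolding ip_def ip0_def by (simp add: mult.commute)
    show "v = 0" if "ip v v = 0" for v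
    proof -
      have sq: "ip0 u u = complex_of_real (\<Sum>b\<in>Basis. (cmod (representation Basis u b))\<^sup>2)" for u
        unfolding ip0_def by (simp add: complex_norm_square[symmetric] del: of_real_power)
      have "complex_of_real (\<Sum>g\<in>W. \<Sum>b\<in>Basis. (cmod (representation Basis (g v) b))\<^sup>2) = 0"
        using that unfolding ip_def sq by simp
      then have "(\<Sum>g\<in>W. \<Sum>b\<in>Basis. (cmod (representation Basis (g v) b))\<^sup>2) = 0"
        using of_real_eq_0_iff by blast
      then have "\<forall>g\<in>W. (\<Sum>b\<in>Basis. (cmod (representation Basis (g v) b))\<^sup>2) = 0"
        using W(2) by (subst (asm) sum_nonneg_eq_0_iff) (auto intro: sum_nonneg)
      \<comment> \<open>The summand at the identity is the squared coordinate norm of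
        \<open>v\<close> itself.\<close>
      moreover have "id \<in> W" using W.one_closed by (simp add: GL_def)
      ultimately have "(\<Sum>b\<in>Basis. (cmod (representation Basis v b))\<^sup>2) = 0" by force
      then have "\<forall>b\<in>Basis. representation Basis v b = 0"
        using fd.finite_Basis by (simp add: sum_nonneg_eq_0_iff)
      then show ?thesis using fd.representation_eq_0_iff by blast
    qed
    show "ip (h v) (h w) = ip v w" if h: "h \<in> W" for h v w
    proof -
      obtain h' where h': "h' \<in> W" "h' \<circ> h = id" "h \<circ> h' = id" using inverse[OF h] by blast
      \<comment> \<open>Right translation by \<open>h\<close> permutes \<open>W\<close>.\<close>
      show ?thesis
        unfolding ip_def
        by (rule sum.reindex_bij_witness[of _ "\<lambda>g. g \<circ> h'" "\<lambda>g. g \<circ> h"])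
          (auto simp: comp h h' o_assoc[symmetric])
    qed
  qed (use W(2) g_add g_scale comp inverse in auto)
  then show ?thesis by blast
qed

theorem theorem1p3:
  fixes scale :: "complex \<Rightarrow> 'v::ab_group_add \<Rightarrow> 'v"
    and Basis :: "'v set"
    and W :: "('v \<Rightarrow> 'v) set"
  assumes "finite_dimensional_vector_space scale Basis"
    and "complex_space.finite_reflection_group scale W"
    and "complex_space.acts_irreducibly scale W"
    and "vector_space.dim scale (UNIV :: 'v set) \<ge> 2"
  shows "complex_space.supersolvable scale (complex_space.reflection_arrangement scale W) \<longleftrightarrow>
    (\<exists>X \<in> intersection_lattice (complex_space.reflection_arrangement scale W).
       modular_element (complex_space.reflection_arrangement scale W) X \<and>
       complex_space.codim scale X = 2)"
proof -
  interpret fd: finite_dimensional_vector_space scale Basis by (rule assms(1))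
  interpret complex_space scale by unfold_locales
  have W: "subgroup W GL" "finite W" "W = generate GL {g \<in> W. reflection g}"
    using assms(2) by (auto simp: finite_reflection_group_def)
  obtain ip where "unitary_group scale Basis ip W"
    using invariant_hermitian_form[OF assms(1) W(1,2)] by blast
  then interpret unitary_group scale Basis ip W .
  interpret irreducible_reflection_group scale Basis ip W
    using irreducible_reflection_groupI[OF equalityD1[OF W(3)] assms(3)] .
  show ?thesis
    unfolding reflection_arrangement_eq
    using supersolvable_imp_modular_codim_2[OF _ assms(4)] modular_codim_2_imp_supersolvable
    by blast
qed

end
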